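(* Every Fredholm sequence in $\mathcal{S}_\eta(\mathcal{O}_N)$ is stable.
   Context: Let $N\ge 2$ be an integer and $\mathbb{Z}^+=\{0,1,2,\dots\}$. For $n\ge 1$, $P_n$ is the orthogonal projection of $l^2(\mathbb{Z}^+)$ onto the span of the first $n$ standard basis vectors. For $i\in\{0,\dots,N-1\}$, $S_i\in L(l^2(\mathbb{Z}^+))$ is the isometry $(S_i x)_{rN+i}=x_r$ for $r\ge 0$, with all other components of $S_ix$ equal to $0$. The concrete Cuntz algebra $\mathcal{O}_N$ is the smallest $C^*$-subalgebra of $L(l^2(\mathbb{Z}^+))$ containing $S_0,\dots,S_{N-1}$. Let $\mathcal{F}_\eta$ (with $\eta(n)=N^n$) be the $C^*$-algebra of all bounded sequences $(A_n)_{n\ge 0}$ with $A_n\in\mathbb{C}^{N^n\times N^n}$ (identified with operators on $\mathrm{im}\,P_{N^n}$), with entrywise operations and supremum norm. $\mathcal{S}_\eta(\mathcal{O}_N)$ is the smallest $C^*$-subalgebra of $\mathcal{F}_\eta$ containing all sequences $(P_{N^n}AP_{N^n})_{n\ge0}$ with $A\in\mathcal{O}_N$. The ideal $\mathcal{K}_\eta$ of compact sequences is the closure in $\mathcal{F}_\eta$ of the set of all sequences $(A_n)\in\mathcal{F}_\eta$ with $\sup_n\mathrm{rank}\,A_n<\infty$; it is a closed two-sided ideal of $\mathcal{F}_\eta$. A sequence in $\mathcal{F}_\eta$ is Fredholm if its coset is invertible in $\mathcal{F}_\eta/\mathcal{K}_\eta$. A sequence $(A_n)\in\mathcal{F}_\eta$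 is stable if there is an $n_0$ such that $A_n$ is invertible for all $n\ge n_0$ and $\sup_{n\ge n_0}\|A_n^{-1}\|<\infty$. *)

theory Defs
  imports "HOL-Analysis.Analysis" "HOL-Algebra.QuotRing"
begin

typedef ell2 = "{x :: nat \<Rightarrow> complex. summable (\<lambda>n. (cmod (x n))\<^sup>2)}"
  morphisms coord Abs_ell2
  by (rule exI[of _ "\<lambda>_. 0"]) simp

setup_lifting type_definition_ell2

lemma coord_summable [simp]: "summable (\<lambda>n. (cmod (coord x n))\<^sup>2)"
  using coord[of x] by simp

lemma ell2_eqI: "(\<And>n. coord x n = coord y n) \<Longrightarrow> x = y"
  by transfer auto

lemma summable_norm_mult:
  fixes x y :: "nat \<Rightarrow> complex"
  assumes "summable (\<lambda>n. (cmod (x n))\<^sup>2)" "summable (\<lambda>n. (cmod (y n))\<^sup>2)"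
  shows "summable (\<lambda>n. cmod (x n) * cmod (y n))"
proof (rule summable_comparison_test'[OF summable_add[OF assms], of 0])
  fix n
  have "0 \<le> (cmod (x n) - cmod (y n))\<^sup>2" "0 \<le> cmod (x n) * cmod (y n)" by simp_all
  then show "norm (cmod (x n) * cmod (y n)) \<le> (cmod (x n))\<^sup>2 + (cmod (y n))\<^sup>2"
    unfolding power2_diff real_norm_def by (simp only: abs_of_nonneg)
qed

lemma summable_sq_add:
  fixes x y :: "nat \<Rightarrow> complex"
  assumes "summable (\<lambda>n. (cmod (x n))\<^sup>2)" "summable (\<lambda>n. (cmod (y n))\<^sup>2)"
  shows "summable (\<lambda>n. (cmod (x n + y n))\<^sup>2)"
proof (rule summable_comparison_test'[of _ 0])
  show "summable (\<lambda>n. (cmod (x n))\<^sup>2 + 2 * (cmod (x n) * cmod (y n)) + (cmod (y n))\<^sup>2)"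
    by (intro summable_add summable_mult summable_norm_mult assms)
  fix n
  have "(cmod (x n + y n))\<^sup>2 \<le> (cmod (x n) + cmod (y n))\<^sup>2"
    by (intro power_mono norm_triangle_ineq) simp
  then show "norm ((cmod (x n + y n))\<^sup>2)
      \<le> (cmod (x n))\<^sup>2 + 2 * (cmod (x n) * cmod (y n)) + (cmod (y n))\<^sup>2"
    by (simp add: power2_sum)
qed

lemma summable_sq_mult:
  fixes x :: "nat \<Rightarrow> complex"
  assumes "summable (\<lambda>n. (cmod (x n))\<^sup>2)"
  shows "summable (\<lambda>n. (cmod (c * x n))\<^sup>2)"
  unfolding norm_mult power_mult_distrib by (intro summable_mult assms)

lift_definition cscale :: "complex \<Rightarrow> ell2 \<Rightarrow> ell2" is "\<lambda>c x n. c * x n"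
  using summable_sq_mult by simp

instantiation ell2 :: real_vector
begin

lift_definition zero_ell2 :: ell2 is "\<lambda>_. 0" by simp
lift_definition plus_ell2 :: "ell2 \<Rightarrow> ell2 \<Rightarrow> ell2" is "\<lambda>x y n. x n + y n"
  using summable_sq_add by simp
lift_definition uminus_ell2 :: "ell2 \<Rightarrow> ell2" is "\<lambda>x n. - x n" by simp
definition minus_ell2 :: "ell2 \<Rightarrow> ell2 \<Rightarrow> ell2" where "minus_ell2 x y = x + - y"
definition scaleR_ell2 :: "real \<Rightarrow> ell2 \<Rightarrow> ell2" where "scaleR_ell2 r = cscale (of_real r)"

instance
proof
  fix x y z :: ell2 and a b :: real
  note coord_eqs = zero_ell2.rep_eq plus_ell2.rep_eq uminus_ell2.rep_eq cscale.rep_eq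
  show "x + y + z = x + (y + z)" by (rule ell2_eqI) (simp add: coord_eqs)
  show "x + y = y + x" by (rule ell2_eqI) (simp add: coord_eqs)
  show "0 + x = x" by (rule ell2_eqI) (simp add: coord_eqs)
  show "- x + x = 0" by (rule ell2_eqI) (simp add: coord_eqs)
  show "x - y = x + - y" by (rule minus_ell2_def)
  show "a *\<^sub>R (x + y) = a *\<^sub>R x + a *\<^sub>R y"
    unfolding scaleR_ell2_def by (rule ell2_eqI) (simp add: coord_eqs distrib_left)
  show "(a + b) *\<^sub>R x = a *\<^sub>R x + b *\<^sub>R x"
    unfolding scaleR_ell2_def by (rule ell2_eqI) (simp add: coord_eqs distrib_right)
  show "a *\<^sub>R b *\<^sub>R x = (a * b) *\<^sub>R x"
    unfolding scaleR_ell2_def by (rule ell2_eqI) (simp add: coord_eqs)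
  show "1 *\<^sub>R x = x"
    unfolding scaleR_ell2_def by (rule ell2_eqI) (simp add: coord_eqs)
qed

end

lemma coord_simps [simp]:
  "coord 0 n = 0" "coord (x + y) n = coord x n + coord y n" "coord (- x) n = - coord x n"
  "coord (x - y) n = coord x n - coord y n" "coord (r *\<^sub>R x) n = r *\<^sub>R coord x n"
  "coord (cscale c x) n = c * coord x n"
  by (simp_all only: zero_ell2.rep_eq plus_ell2.rep_eq uminus_ell2.rep_eq cscale.rep_eq
      minus_ell2_def scaleR_ell2_def scaleR_conv_of_real add_uminus_conv_diff[symmetric, where 'a = complex])

lemma coord_sum [simp]: "coord (sum f I) n = (\<Sum>i\<in>I. coord (f i) n)"
  by (induction I rule: infinite_finite_induct) auto

lemma summable_inner_coord: "summable (\<lambda>n. inner (coord x n) (coord y n))"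
  by (rule summable_comparison_test'[OF summable_norm_mult[OF coord_summable[of x] coord_summable[of y]], of 0])
    (simp add: Cauchy_Schwarz_ineq2)

instantiation ell2 :: real_inner
begin

definition inner_ell2 :: "ell2 \<Rightarrow> ell2 \<Rightarrow> real"
  where "inner_ell2 x y = (\<Sum>n. inner (coord x n) (coord y n))"
definition norm_ell2 :: "ell2 \<Rightarrow> real" where "norm_ell2 x = sqrt (inner x x)"
definition sgn_ell2 :: "ell2 \<Rightarrow> ell2" where "sgn_ell2 x = x /\<^sub>R norm x"
definition dist_ell2 :: "ell2 \<Rightarrow> ell2 \<Rightarrow> real" where "dist_ell2 x y = norm (x - y)"
definition uniformity_ell2 :: "(ell2 \<times> ell2) filter"
  where "uniformity_ell2 = (INF e\<in>{0<..}. principal {(x, y). dist x y < e})"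
definition open_ell2 :: "ell2 set \<Rightarrow> bool"
  where "open_ell2 U \<longleftrightarrow> (\<forall>x\<in>U. \<forall>\<^sub>F (x', y) in uniformity. x' = x \<longrightarrow> y \<in> U)"

instance
proof
  fix x y z :: ell2 and r :: real
  show "inner x y = inner y x"
    by (simp add: inner_ell2_def inner_commute)
  show "inner (x + y) z = inner x z + inner y z"
    by (simp add: inner_ell2_def inner_add_left suminf_add summable_inner_coord)
  show "inner (r *\<^sub>R x) y = r * inner x y"
    using suminf_mult[OF summable_inner_coord[of x y], of r] by (simp add: inner_ell2_def)
  show "0 \<le> inner x x"
    unfolding inner_ell2_def by (rule suminf_nonneg[OF summable_inner_coord]) simp
  show "inner x x = 0 \<longleftrightarrow> x = 0"
  proof
    assume "inner x x = 0"
    then have "\<forall>n. inner (coord x n) (coord x n) = 0"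
      unfolding inner_ell2_def by (subst (asm) suminf_eq_zero_iff[OF summable_inner_coord]) auto
    then show "x = 0" by (intro ell2_eqI) simp
  qed (simp add: inner_ell2_def)
qed (simp_all add: sgn_ell2_def norm_ell2_def dist_ell2_def uniformity_ell2_def open_ell2_def)

end

lemma norm_ell2_sq: "(norm x)\<^sup>2 = (\<Sum>n. (cmod (coord x n))\<^sup>2)" for x :: ell2
  unfolding power2_norm_eq_inner by (simp add: inner_ell2_def dot_square_norm)

lemma norm_cscale [simp]: "norm (cscale c x) = cmod c * norm x"
proof -
  have "(norm (cscale c x))\<^sup>2 = (cmod c * norm x)\<^sup>2"
    unfolding power_mult_distrib norm_ell2_sq
    by (simp add: norm_mult power_mult_distrib suminf_mult)
  then show ?thesis by (rule power2_eq_imp_eq) simp_all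
qed

interpretation ell2: vector_space cscale
  by standard (auto intro!: ell2_eqI simp: algebra_simps)

definition cinner :: "ell2 \<Rightarrow> ell2 \<Rightarrow> complex"
  where "cinner x y = (\<Sum>n. coord x n * cnj (coord y n))"

lemma summable_cinner: "summable (\<lambda>n. coord x n * cnj (coord y n))"
  by (rule summable_comparison_test'[OF summable_norm_mult[OF coord_summable[of x] coord_summable[of y]], of 0])
    (simp add: norm_mult)

lemma cinner_add_left: "cinner (x + x') y = cinner x y + cinner x' y"
  by (simp add: cinner_def distrib_right suminf_add summable_cinner)

lemma cinner_add_right: "cinner x (y + y') = cinner x y + cinner x y'"
  by (simp add: cinner_def distrib_left suminf_add summable_cinner)

lemma cinner_cscale_left [simp]: "cinner (cscale c x) y = c * cinner x y"
  using suminf_mult[OF summable_cinner[of x y], of c] by (simp add: cinner_def mult_ac)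

lemma cinner_cscale_right [simp]: "cinner x (cscale c y) = cnj c * cinner x y"
  using suminf_mult[OF summable_cinner[of x y], of "cnj c"] by (simp add: cinner_def mult_ac)

lemma Re_cinner: "Re (cinner x y) = inner x y"
proof -
  have "Re (cinner x y) = (\<Sum>n. Re (coord x n * cnj (coord y n)))"
    unfolding cinner_def
    by (rule sums_unique[OF bounded_linear.sums[OF bounded_linear_Re summable_sums[OF summable_cinner]]])
  then show ?thesis by (simp add: inner_ell2_def inner_complex_def)
qed

lemma cinner_commute: "cinner x y = cnj (cinner y x)"
proof -
  have "cnj (cinner y x) = (\<Sum>n. cnj (coord y n * cnj (coord x n)))"
    unfolding cinner_def
    by (rule sums_unique[OF bounded_linear.sums[OF bounded_linear_cnj summable_sums[OF summable_cinner]]])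
  then show ?thesis by (simp add: cinner_def mult_ac)
qed

lemma norm_cinner_le: "cmod (cinner x y) \<le> norm x * norm y"
proof (cases "cinner x y = 0")
  case False
  define c where "c = cnj (sgn (cinner x y))"
  have c: "cmod c = 1" using False by (simp add: c_def norm_sgn)
  have "cnj w * w = of_real (cmod w) * of_real (cmod w)" for w
    using complex_norm_square[of w] by (simp add: power2_eq_square mult.commute)
  then have "cinner (cscale c x) y = of_real (cmod (cinner x y))"
    using False by (simp add: c_def sgn_div_norm scaleR_conv_of_real field_simps)
  then have "cmod (cinner x y) = inner (cscale c x) y"
    by (metis Re_cinner Re_complex_of_real)
  also have "\<dots> \<le> norm (cscale c x) * norm y" by (rule norm_cauchy_schwarz)
  finally show ?thesis by (simp add: c)
qed simp

lemma scaleR_ell2_cscale: "r *\<^sub>R x = cscale (of_real r) x" for x :: ell2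
  by (simp add: scaleR_ell2_def)

lemma bounded_bilinear_cinner: "bounded_bilinear cinner"
proof
  show "\<exists>K. \<forall>a b. cmod (cinner a b) \<le> norm a * norm b * K"
    using norm_cinner_le by (intro exI[of _ 1]) simp
qed (simp_all add: cinner_add_left cinner_add_right scaleR_ell2_cscale scaleR_conv_of_real)

text \<open>
  The type \<open>ell2 \<Rightarrow>\<^sub>L ell2\<close> consists of the bounded real-linear maps; the complex-linear ones
  are singled out by \<open>clinear_ops\<close>.
\<close>

type_synonym ell2_op = "ell2 \<Rightarrow>\<^sub>L ell2"

definition clinear_ops :: "ell2_op set"
  where "clinear_ops = {A. \<forall>c x. blinfun_apply A (cscale c x) = cscale c (blinfun_apply A x)}"

lemma clinear_opsD: "A \<in> clinear_ops \<Longrightarrow> blinfun_apply A (cscale c x) = cscale c (blinfun_apply A x)"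
  by (simp add: clinear_ops_def)

definition is_adjoint :: "ell2_op \<Rightarrow> ell2_op \<Rightarrow> bool"
  where "is_adjoint A B \<longleftrightarrow>
    (\<forall>x y. cinner (blinfun_apply A x) y = cinner x (blinfun_apply B y))"

definition adjoint_op :: "ell2_op \<Rightarrow> ell2_op"
  where "adjoint_op A = (THE B. is_adjoint A B)"

definition op_cscale :: "complex \<Rightarrow> ell2_op \<Rightarrow> ell2_op"
  where "op_cscale c A = Blinfun (\<lambda>x. cscale c (blinfun_apply A x))"

lemma op_cscale_apply: "blinfun_apply (op_cscale c A) x = cscale c (blinfun_apply A x)"
proof -
  have "bounded_linear (cscale c)"
    by (rule bounded_linear_intro[where K = "cmod c"]) (auto intro: ell2_eqI simp: algebra_simps)
  then have "bounded_linear (\<lambda>x. cscale c (blinfun_apply A x))"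
    by (rule bounded_linear_compose) (rule blinfun.bounded_linear_right)
  then show ?thesis by (simp add: op_cscale_def bounded_linear_Blinfun_apply)
qed

lemma norm_op_cscale_le: "norm (op_cscale c A) \<le> cmod c * norm A"
proof (rule norm_blinfun_bound)
  fix x
  show "norm (blinfun_apply (op_cscale c A) x) \<le> cmod c * norm A * norm x"
    using mult_left_mono[OF norm_blinfun[of A x], of "cmod c"]
    by (simp add: op_cscale_apply mult.assoc)
qed simp

lift_definition proj_fun :: "nat \<Rightarrow> ell2 \<Rightarrow> ell2" is "\<lambda>m x k. if k < m then x k else 0"
proof -
  fix m and x :: "nat \<Rightarrow> complex" assume "summable (\<lambda>n. (cmod (x n))\<^sup>2)"
  then show "summable (\<lambda>k. (cmod (if k < m then x k else 0))\<^sup>2)"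
    by (auto intro!: summable_comparison_test'[of "\<lambda>n. (cmod (x n))\<^sup>2" 0])
qed

lift_definition proj :: "nat \<Rightarrow> ell2_op" is proj_fun
proof (rule bounded_linear_intro[where K = 1])
  fix m x
  have "(norm (proj_fun m x))\<^sup>2 \<le> (norm x)\<^sup>2"
    unfolding norm_ell2_sq by (rule suminf_le[OF _ coord_summable coord_summable]) (simp add: proj_fun.rep_eq)
  then show "norm (proj_fun m x) \<le> norm x * 1" by (simp add: power2_le_iff_abs_le)
qed (auto intro: ell2_eqI simp: proj_fun.rep_eq)

lemma coord_proj: "coord (blinfun_apply (proj m) x) k = (if k < m then coord x k else 0)"
  by (simp add: proj.rep_eq proj_fun.rep_eq)

lemma sum_shift_le:
  fixes f :: "nat \<Rightarrow> real"
  assumes f: "summable f" "\<And>n. 0 \<le> f n"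
  shows "(\<Sum>k<m. if k mod N = i then f (k div N) else 0) \<le> suminf f"
proof -
  have inj: "inj_on (\<lambda>k. k div N) {k \<in> {..<m}. k mod N = i}"
    by (rule inj_onI) (metis (mono_tags, lifting) div_mult_mod_eq mem_Collect_eq)
  have "(\<Sum>k<m. if k mod N = i then f (k div N) else 0) = (\<Sum>k | k \<in> {..<m} \<and> k mod N = i. f (k div N))"
    by (simp add: sum.If_cases Int_def)
  also have "\<dots> = sum f ((\<lambda>k. k div N) ` {k \<in> {..<m}. k mod N = i})"
    by (subst sum.reindex[OF inj]) (simp add: o_def)
  also have "\<dots> \<le> suminf f" by (rule sum_le_suminf) (use f in auto)
  finally show ?thesis .
qed

lift_definition shift_fun :: "nat \<Rightarrow> nat \<Rightarrow> ell2 \<Rightarrow> ell2"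
  is "\<lambda>N i x k. if k mod N = i then x (k div N) else 0"
proof -
  fix N i and x :: "nat \<Rightarrow> complex" assume x: "summable (\<lambda>n. (cmod (x n))\<^sup>2)"
  have eq: "(cmod (if k mod N = i then x (k div N) else 0))\<^sup>2
      = (if k mod N = i then (cmod (x (k div N)))\<^sup>2 else 0)" for k by simp
  show "summable (\<lambda>k. (cmod (if k mod N = i then x (k div N) else 0))\<^sup>2)"
    unfolding eq
    by (rule summableI_nonneg_bounded[OF _ sum_shift_le[OF x]]) auto
qed

text \<open>
  For \<open>i < N\<close>, \<open>cuntz_iso N i\<close> is the isometry \<open>S\<^sub>i\<close>; see \<open>coord_cuntz_iso_mult_add\<close> and
  \<open>norm_cuntz_iso\<close> below.
\<close>

lift_definition cuntz_iso :: "nat \<Rightarrow> nat \<Rightarrow> ell2_op" is shift_fun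
proof (rule bounded_linear_intro[where K = 1])
  fix N i x
  have eq: "(cmod (coord (shift_fun N i x) k))\<^sup>2
      = (if k mod N = i then (cmod (coord x (k div N)))\<^sup>2 else 0)" for k
    by (simp add: shift_fun.rep_eq)
  have "(norm (shift_fun N i x))\<^sup>2 \<le> (norm x)\<^sup>2"
    unfolding norm_ell2_sq
    by (rule suminf_le_const[OF coord_summable], unfold eq, rule sum_shift_le) simp_all
  then show "norm (shift_fun N i x) \<le> norm x * 1" by (simp add: power2_le_iff_abs_le)
qed (auto intro: ell2_eqI simp: shift_fun.rep_eq)

lemma coord_cuntz_iso:
  "coord (blinfun_apply (cuntz_iso N i) x) k = (if k mod N = i then coord x (k div N) else 0)"
  by (simp add: cuntz_iso.rep_eq shift_fun.rep_eq)

lemma coord_cuntz_iso_mult_add: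
  "i < N \<Longrightarrow> coord (blinfun_apply (cuntz_iso N i) x) (r * N + i) = coord x r"
  by (simp add: coord_cuntz_iso)

lemma norm_cuntz_iso:
  assumes "i < N"
  shows "norm (blinfun_apply (cuntz_iso N i) x) = norm x"
proof -
  let ?f = "\<lambda>k. (cmod (coord (blinfun_apply (cuntz_iso N i) x) k))\<^sup>2"
  have mono: "strict_mono (\<lambda>r. r * N + i)" using assms by (intro strict_monoI) simp
  have zero: "?f k = 0" if "k \<notin> range (\<lambda>r. r * N + i)" for k
  proof -
    have "k mod N \<noteq> i" using that div_mult_mod_eq[of k N] by (metis rangeI)
    then show "?f k = 0" by (simp add: coord_cuntz_iso)
  qed
  have "(\<Sum>r. ?f (r * N + i)) = suminf ?f"
    by (rule suminf_mono_reindex[OF mono zero])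
  then have "(norm (blinfun_apply (cuntz_iso N i) x))\<^sup>2 = (norm x)\<^sup>2"
    unfolding norm_ell2_sq using assms by (simp add: coord_cuntz_iso_mult_add)
  then show ?thesis by (rule power2_eq_imp_eq) simp_all
qed

lift_definition unit_vec :: "nat \<Rightarrow> ell2" is "\<lambda>k n. if n = k then 1 else 0"
proof -
  fix k :: nat
  show "summable (\<lambda>n. (cmod (if n = k then 1 else 0))\<^sup>2)"
    by (rule summable_finite[of "{k}"]) auto
qed

lemma coord_unit_vec: "coord (unit_vec k) n = (if n = k then 1 else 0)"
  by (simp add: unit_vec.rep_eq)

lemma cinner_unit_vec: "cinner (unit_vec k) y = cnj (coord y k)"
  unfolding cinner_def by (subst suminf_finite[of "{k}"]) (auto simp: coord_unit_vec)

lemma proj_eq_sum: "blinfun_apply (proj m) x = (\<Sum>k<m. cscale (coord x k) (unit_vec k))"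
  by (rule ell2_eqI) (auto simp: coord_proj coord_unit_vec if_distrib cong: if_cong)

lemma proj_tendsto: "(\<lambda>m. blinfun_apply (proj m) x) \<longlonglongrightarrow> x"
proof -
  let ?f = "\<lambda>n. (cmod (coord x n))\<^sup>2"
  have "(norm (x - blinfun_apply (proj m) x))\<^sup>2 = suminf ?f - (\<Sum>n<m. ?f n)" for m
  proof -
    have "(norm (x - blinfun_apply (proj m) x))\<^sup>2 = (\<Sum>n. ?f n - (if n < m then ?f n else 0))"
      unfolding norm_ell2_sq by (rule suminf_cong) (simp add: coord_proj)
    also have "\<dots> = suminf ?f - (\<Sum>n. if n < m then ?f n else 0)"
      by (rule suminf_diff[symmetric]) (auto intro: summable_finite[of "{..<m}"])
    also have "(\<Sum>n. if n < m then ?f n else 0) = (\<Sum>n<m. ?f n)"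
      by (subst suminf_finite[of "{..<m}"]) auto
    finally show ?thesis .
  qed
  moreover have "(\<lambda>m. suminf ?f - (\<Sum>n<m. ?f n)) \<longlonglongrightarrow> suminf ?f - suminf ?f"
    by (intro tendsto_intros summable_LIMSEQ) simp
  ultimately have "(\<lambda>m. sqrt ((norm (x - blinfun_apply (proj m) x))\<^sup>2)) \<longlonglongrightarrow> sqrt 0"
    by (intro tendsto_real_sqrt) simp
  then have "(\<lambda>m. norm (blinfun_apply (proj m) x - x)) \<longlonglongrightarrow> 0"
    by (simp only: norm_minus_commute[of x] real_sqrt_abs abs_norm_cancel real_sqrt_zero)
  from LIM_zero_cancel[OF tendsto_norm_zero_cancel[OF this]] show ?thesis .
qed

lemma is_adjoint_unique:
  assumes "is_adjoint A B" "is_adjoint A C"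
  shows "B = C"
proof (rule blinfun_eqI, rule ell2_eqI)
  fix y k
  have "cinner (unit_vec k) (blinfun_apply B y) = cinner (unit_vec k) (blinfun_apply C y)"
    using assms unfolding is_adjoint_def by metis
  then show "coord (blinfun_apply B y) k = coord (blinfun_apply C y) k"
    by (simp add: cinner_unit_vec)
qed

lemma is_adjoint_exists:
  assumes A: "A \<in> clinear_ops"
  shows "\<exists>B. is_adjoint A B \<and> norm B \<le> norm A"
proof -
  interpret C: bounded_bilinear cinner by (rule bounded_bilinear_cinner)
  define b where "b y k = cinner y (blinfun_apply A (unit_vec k))" for y k
  have A_sum: "blinfun_apply A (\<Sum>k<n. cscale (c k) (unit_vec k))
      = (\<Sum>k<n. cscale (c k) (blinfun_apply A (unit_vec k)))" for c n
    by (simp add: blinfun.sum_right clinear_opsD[OF A])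
  have le: "(\<Sum>k<n. (cmod (b y k))\<^sup>2) \<le> (norm A * norm y)\<^sup>2" for y n
  proof -
    define z where "z = (\<Sum>k<n. cscale (b y k) (unit_vec k))"
    define s where "s = (\<Sum>k<n. (cmod (b y k))\<^sup>2)"
    have coord_z: "coord z k = (if k < n then b y k else 0)" for k
      by (auto simp: z_def coord_unit_vec if_distrib cong: if_cong)
    have nz: "(norm z)\<^sup>2 = s"
      unfolding norm_ell2_sq s_def
      by (subst suminf_finite[of "{..<n}"]) (auto simp: coord_z)
    have "cinner y (blinfun_apply A z) = (\<Sum>k<n. cnj (b y k) * b y k)"
      by (simp add: z_def A_sum C.sum_right b_def)
    also have "\<dots> = of_real s"
      unfolding s_def of_real_sum
      by (rule sum.cong) (simp_all only: mult.commute[of "cnj _"] complex_norm_square)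
    finally have eq: "cinner y (blinfun_apply A z) = of_real s" .
    have "s \<ge> 0" by (simp add: s_def sum_nonneg)
    then have "s = cmod (cinner y (blinfun_apply A z))" by (simp add: eq)
    also have "\<dots> \<le> norm y * norm (blinfun_apply A z)" by (rule norm_cinner_le)
    also have "\<dots> \<le> norm y * (norm A * norm z)" by (intro mult_left_mono norm_blinfun) simp
    finally have "norm z * norm z \<le> (norm A * norm y) * norm z"
      using nz by (simp add: power2_eq_square mult_ac)
    then have "norm z \<le> norm A * norm y"
      by (cases "z = 0") auto
    then show ?thesis using nz s_def by (metis norm_ge_zero power_mono)
  qed
  have summ: "summable (\<lambda>k. (cmod (b y k))\<^sup>2)" for y
    by (rule summableI_nonneg_bounded[OF _ le]) simp
  define B where "B y = Abs_ell2 (b y)" for y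
  have coord_B: "coord (B y) k = b y k" for y k
    by (simp add: B_def Abs_ell2_inverse summ)
  have norm_B: "norm (B y) \<le> norm A * norm y" for y
  proof -
    have "(norm (B y))\<^sup>2 \<le> (norm A * norm y)\<^sup>2"
      unfolding norm_ell2_sq coord_B by (rule suminf_le_const[OF summ le])
    then show ?thesis by (rule power2_le_imp_le) simp
  qed
  have bl: "bounded_linear B"
    by (rule bounded_linear_intro[where K = "norm A"])
      (auto intro!: ell2_eqI simp: coord_B b_def C.add_left C.scaleR_left norm_B mult.commute[of _ "norm A"])
  have "cinner (blinfun_apply A x) y = cinner x (B y)" for x y
  proof (rule LIMSEQ_unique)
    show "(\<lambda>m. cinner (blinfun_apply A (blinfun_apply (proj m) x)) y) \<longlonglongrightarrow> cinner (blinfun_apply A x) y"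
      by (intro C.tendsto blinfun.tendsto tendsto_const proj_tendsto)
    have "cinner (blinfun_apply A (blinfun_apply (proj m) x)) y = cinner (blinfun_apply (proj m) x) (B y)" for m
      by (simp add: proj_eq_sum A_sum C.sum_left cinner_unit_vec coord_B b_def
          cinner_commute[of "blinfun_apply A _" y])
    then show "(\<lambda>m. cinner (blinfun_apply A (blinfun_apply (proj m) x)) y) \<longlonglongrightarrow> cinner x (B y)"
      by (simp add: C.tendsto proj_tendsto)
  qed
  then have "is_adjoint A (Blinfun B)"
    by (simp add: is_adjoint_def bounded_linear_Blinfun_apply bl)
  moreover have "norm (Blinfun B) \<le> norm A"
    by (rule norm_blinfun_bound) (simp_all add: bounded_linear_Blinfun_apply bl norm_B)
  ultimately show ?thesis by blast
qed

lemma adjoint_op_eq: "is_adjoint A B \<Longrightarrow> adjoint_op A = B"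
  unfolding adjoint_op_def using is_adjoint_unique by blast

lemma is_adjoint_adjoint_op: "A \<in> clinear_ops \<Longrightarrow> is_adjoint A (adjoint_op A)"
  using is_adjoint_exists adjoint_op_eq by blast

lemma norm_adjoint_op_le: "A \<in> clinear_ops \<Longrightarrow> norm (adjoint_op A) \<le> norm A"
  using is_adjoint_exists adjoint_op_eq by blast

text \<open>
  The ambient C*-algebra is a norm-closed carrier \<open>X\<close> inside a real normed space, with its complex
  scaling, product and involution passed explicitly.
\<close>

definition cstar_subalgebra ::
  "'a::real_normed_vector set \<Rightarrow> (complex \<Rightarrow> 'a \<Rightarrow> 'a) \<Rightarrow> ('a \<Rightarrow> 'a \<Rightarrow> 'a) \<Rightarrow> ('a \<Rightarrow> 'a) \<Rightarrow> 'a set \<Rightarrow> bool"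
  where "cstar_subalgebra X smul mul star B \<longleftrightarrow>
    B \<subseteq> X \<and> closed B \<and> 0 \<in> B \<and>
    (\<forall>a\<in>B. \<forall>b\<in>B. a + b \<in> B \<and> mul a b \<in> B) \<and>
    (\<forall>c. \<forall>a\<in>B. smul c a \<in> B) \<and>
    (\<forall>a\<in>B. star a \<in> B)"

definition cstar_generated ::
  "'a::real_normed_vector set \<Rightarrow> (complex \<Rightarrow> 'a \<Rightarrow> 'a) \<Rightarrow> ('a \<Rightarrow> 'a \<Rightarrow> 'a) \<Rightarrow> ('a \<Rightarrow> 'a) \<Rightarrow> 'a set \<Rightarrow> 'a set"
  where "cstar_generated X smul mul star G =
    \<Inter>{B. cstar_subalgebra X smul mul star B \<and> G \<subseteq> B}"

definition cuntz_algebra :: "nat \<Rightarrow> ell2_op set"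
  where "cuntz_algebra N =
    cstar_generated clinear_ops op_cscale (o\<^sub>L) adjoint_op (cuntz_iso N ` {..<N})"

text \<open>
  An \<open>m \<times> m\<close> matrix is identified with an operator on the range of \<open>proj m\<close>, extended by zero;
  this preserves the operator norm, products and adjoints, and turns the identity matrix into
  \<open>proj m\<close>.
\<close>

definition matrix_ops :: "nat \<Rightarrow> ell2_op set"
  where "matrix_ops m = {A \<in> clinear_ops. proj m o\<^sub>L A o\<^sub>L proj m = A}"

text \<open>
  Since \<open>nat\<close> is discrete, \<open>nat \<Rightarrow>\<^sub>C ell2_op\<close> is the type of all bounded sequences, normed by the
  supremum norm.
\<close>

type_synonym op_seq = "nat \<Rightarrow>\<^sub>C ell2_op"

lemma bcontfun_natI: "(\<And>n. norm (f n) \<le> C) \<Longrightarrow> f \<in> bcontfun"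
  for f :: "nat \<Rightarrow> 'a::real_normed_vector"
  by (auto simp: bcontfun_def bounded_iff continuous_on_discrete)

lemma op_seq_boundE:
  fixes A :: op_seq
  obtains a where "0 \<le> a" "\<And>n. norm (A n) \<le> a"
  using bounded_apply_bcontfun[of A] unfolding bounded_iff
  by (metis norm_ge_zero order_trans rangeI)

definition seq_mult :: "op_seq \<Rightarrow> op_seq \<Rightarrow> op_seq"
  where "seq_mult A B = Bcontfun (\<lambda>n. A n o\<^sub>L B n)"

lemma seq_mult_apply: "seq_mult A B n = A n o\<^sub>L B n"
proof -
  obtain a b where ab: "0 \<le> a" "\<And>n. norm (A n) \<le> a" "\<And>n. norm (B n) \<le> b"
    using op_seq_boundE by metis
  have "(\<lambda>n. A n o\<^sub>L B n) \<in> bcontfun"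
    by (intro bcontfun_natI[of _ "a * b"] order_trans[OF norm_blinfun_compose mult_mono] ab) simp
  then show ?thesis by (simp add: seq_mult_def Bcontfun_inverse)
qed

definition seq_cscale :: "complex \<Rightarrow> op_seq \<Rightarrow> op_seq"
  where "seq_cscale c A = Bcontfun (\<lambda>n. op_cscale c (A n))"

lemma seq_cscale_apply: "seq_cscale c A n = op_cscale c (A n)"
proof -
  obtain a where a: "\<And>n. norm (A n) \<le> a"
    using op_seq_boundE by metis
  have "(\<lambda>n. op_cscale c (A n)) \<in> bcontfun"
    by (intro bcontfun_natI[of _ "cmod c * a"] order_trans[OF norm_op_cscale_le mult_left_mono] a) simp
  then show ?thesis by (simp add: seq_cscale_def Bcontfun_inverse)
qed

definition seq_adjoint :: "op_seq \<Rightarrow> op_seq"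
  where "seq_adjoint A = Bcontfun (\<lambda>n. adjoint_op (A n))"

definition F_eta :: "nat \<Rightarrow> op_seq set"
  where "F_eta N = {A :: op_seq. \<forall>n. A n \<in> matrix_ops (N ^ n)}"

lemma seq_adjoint_apply:
  assumes "A \<in> F_eta N"
  shows "seq_adjoint A n = adjoint_op (A n)"
proof -
  obtain a where a: "\<And>n. norm (A n) \<le> a"
    using bounded_apply_bcontfun[of A] by (auto simp: bounded_iff)
  have "(\<lambda>n. adjoint_op (A n)) \<in> bcontfun"
    using assms a
    by (intro bcontfun_natI[of _ a] order_trans[OF norm_adjoint_op_le])
      (auto simp: F_eta_def matrix_ops_def)
  then show ?thesis by (simp add: seq_adjoint_def Bcontfun_inverse)
qed

definition seq_one :: "nat \<Rightarrow> op_seq"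
  where "seq_one N = Bcontfun (\<lambda>n. proj (N ^ n))"

lemma norm_proj_le: "norm (proj m) \<le> 1"
proof (rule norm_blinfun_bound)
  fix x
  have "(norm (blinfun_apply (proj m) x))\<^sup>2 \<le> (norm x)\<^sup>2"
    unfolding norm_ell2_sq by (rule suminf_le[OF _ coord_summable coord_summable]) (simp add: coord_proj)
  then show "norm (blinfun_apply (proj m) x) \<le> 1 * norm x"
    by (simp add: power2_le_iff_abs_le)
qed simp

lemma seq_one_apply: "seq_one N n = proj (N ^ n)"
proof -
  have "(\<lambda>n. proj (N ^ n)) \<in> bcontfun"
    by (rule bcontfun_natI, rule norm_proj_le)
  then show ?thesis by (simp add: seq_one_def Bcontfun_inverse)
qed

definition F_eta_ring :: "nat \<Rightarrow> op_seq ring"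
  where "F_eta_ring N =
    \<lparr>carrier = F_eta N, mult = seq_mult, one = seq_one N, zero = 0, add = (+)\<rparr>"

definition truncations :: "nat \<Rightarrow> ell2_op \<Rightarrow> op_seq"
  where "truncations N A = Bcontfun (\<lambda>n. proj (N ^ n) o\<^sub>L A o\<^sub>L proj (N ^ n))"

lemma truncations_apply: "truncations N A n = proj (N ^ n) o\<^sub>L A o\<^sub>L proj (N ^ n)"
proof -
  have "(\<lambda>n. proj (N ^ n) o\<^sub>L A o\<^sub>L proj (N ^ n)) =
      apply_bcontfun (seq_mult (seq_mult (seq_one N) (const_bcontfun A)) (seq_one N))"
    by (simp add: fun_eq_iff seq_mult_apply seq_one_apply const_bcontfun.rep_eq)
  then show ?thesis by (simp add: truncations_def apply_bcontfun_inverse seq_mult_apply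
      seq_one_apply const_bcontfun.rep_eq)
qed

definition S_eta :: "nat \<Rightarrow> op_seq set"
  where "S_eta N =
    cstar_generated (F_eta N) seq_cscale seq_mult seq_adjoint (truncations N ` cuntz_algebra N)"

text \<open>
  The complex dimension of the range. \<open>ell2.dim\<close> is \<open>0\<close> for infinite-dimensional spaces, so this
  is the rank only for operators of finite rank, such as the members of \<open>matrix_ops m\<close>.
\<close>

definition rank_op :: "ell2_op \<Rightarrow> nat"
  where "rank_op A = ell2.dim (range (blinfun_apply A))"

definition K_eta :: "nat \<Rightarrow> op_seq set"
  where "K_eta N = closure {A \<in> F_eta N. bdd_above (range (\<lambda>n. rank_op (A n)))}"

definition fredholm :: "nat \<Rightarrow> op_seq \<Rightarrow> bool"
  where "fredholm N A \<longleftrightarrow>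
    A \<in> F_eta N \<and> K_eta N +>\<^bsub>F_eta_ring N\<^esub> A \<in> Units (F_eta_ring N Quot K_eta N)"

definition is_inverse :: "nat \<Rightarrow> ell2_op \<Rightarrow> ell2_op \<Rightarrow> bool"
  where "is_inverse m A B \<longleftrightarrow>
    B \<in> matrix_ops m \<and> A o\<^sub>L B = proj m \<and> B o\<^sub>L A = proj m"

definition stable_seq :: "nat \<Rightarrow> op_seq \<Rightarrow> bool"
  where "stable_seq N A \<longleftrightarrow>
    A \<in> F_eta N \<and> (\<exists>n0 C. \<forall>n\<ge>n0. \<exists>B. is_inverse (N ^ n) (A n) B \<and> norm B \<le> C)"

end

theory Submission
  imports Defs
begin

text \<open>
  A failure of stability replicates itself, which is impossible modulo compact sequences. Index the basis
  of \<open>im P\<close> for the projection \<open>P\<close> of rank \<open>N ^ n\<close> by the \<open>N\<close>-ary expansions of at most \<open>n\<close> digits.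
  Then \<open>S\<^sub>i\<close> appends the last digit \<open>i\<close> and is cut off at length \<open>n\<close>. For a word \<open>v\<close> of \<open>m + 1\<close> digits, the map
  \<open>embed N n v\<close> sends \<open>r\<close> to an average of the words \<open>v 0 \<dots> 0 r\<close>, taken over many numbers of zeros as
  long as \<open>r\<close> is short, so that it nearly respects \<open>S\<^sub>0\<close> fixing the word \<open>0\<close>; as \<open>r\<close> becomes longer,
  it moves slowly to a single padding, the one for which words of full length \<open>n\<close> go to words of full
  length \<open>m + 2 * n + 2\<close>. Hence it nearly intertwines the truncated \<open>S\<^sub>i\<close> and their adjoints, with an error
  that vanishes as \<open>n\<close> grows, and therefore all sequences in \<open>S_eta N\<close>. If \<open>x\<close> is nearly annihilated
  by the \<open>n\<close>-th matrix, then so are its images under the embeddings for arbitrarily many \<open>v\<close>, which are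
  orthogonal. A left inverse modulo sequences of bounded rank does not allow this.
\<close>

section \<open>Adjoints\<close>

lemma coord_eq_cinner: "coord x k = cnj (cinner (unit_vec k) x)"
  by (simp add: cinner_unit_vec)

lemma ell2_eqI_cinner: "(\<And>z. cinner z x = cinner z y) \<Longrightarrow> x = y"
  by (rule ell2_eqI) (simp add: coord_eq_cinner)

lemma is_adjoint_sym: "is_adjoint A B \<Longrightarrow> is_adjoint B A"
  unfolding is_adjoint_def by (metis cinner_commute)

text \<open>The operator type also contains maps that are only real-linear. Complex linearity of
  \<open>B\<close> comes from \<open>cinner\<close> being conjugate-linear in its second slot and
  separating points.\<close>

lemma is_adjoint_clinear:
  assumes "is_adjoint A B"
  shows "B \<in> clinear_ops"
  unfolding clinear_ops_def
proof (intro CollectI allI ell2_eqI_cinner)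
  fix c x z
  have "cinner w (blinfun_apply B y) = cinner (blinfun_apply A w) y" for w y
    using assms by (simp add: is_adjoint_def)
  then show "cinner z (blinfun_apply B (cscale c x)) = cinner z (cscale c (blinfun_apply B x))"
    by simp
qed

lemma adjoint_op_clinear: "A \<in> clinear_ops \<Longrightarrow> adjoint_op A \<in> clinear_ops"
  using is_adjoint_adjoint_op is_adjoint_clinear by blast

lemma adjoint_op_adjoint_op: "A \<in> clinear_ops \<Longrightarrow> adjoint_op (adjoint_op A) = A"
  by (rule adjoint_op_eq[OF is_adjoint_sym[OF is_adjoint_adjoint_op]])

lemma clinear_ops_closed_ops:
  "0 \<in> clinear_ops"
  "id_blinfun \<in> clinear_ops"
  "proj m \<in> clinear_ops"
  "cuntz_iso N i \<in> clinear_ops"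
  "A \<in> clinear_ops \<Longrightarrow> B \<in> clinear_ops \<Longrightarrow> A + B \<in> clinear_ops"
  "A \<in> clinear_ops \<Longrightarrow> B \<in> clinear_ops \<Longrightarrow> A - B \<in> clinear_ops"
  "A \<in> clinear_ops \<Longrightarrow> B \<in> clinear_ops \<Longrightarrow> A o\<^sub>L B \<in> clinear_ops"
  "A \<in> clinear_ops \<Longrightarrow> op_cscale c A \<in> clinear_ops"
  unfolding clinear_ops_def
  by (auto intro!: ell2_eqI simp: blinfun.add_left blinfun.diff_left op_cscale_apply coord_proj
      coord_cuntz_iso algebra_simps)

lemma is_adjoint_add:
  "is_adjoint A A' \<Longrightarrow> is_adjoint B B' \<Longrightarrow> is_adjoint (A + B) (A' + B')"
  by (simp add: is_adjoint_def blinfun.add_left cinner_add_left cinner_add_right)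

lemma is_adjoint_compose:
  "is_adjoint A A' \<Longrightarrow> is_adjoint B B' \<Longrightarrow> is_adjoint (A o\<^sub>L B) (B' o\<^sub>L A')"
  by (simp add: is_adjoint_def)

lemma is_adjoint_op_cscale: "is_adjoint A A' \<Longrightarrow> is_adjoint (op_cscale c A) (op_cscale (cnj c) A')"
  by (simp add: is_adjoint_def op_cscale_apply)

lemma is_adjoint_proj: "is_adjoint (proj m) (proj m)"
  by (auto simp: is_adjoint_def cinner_def coord_proj intro!: suminf_cong)

lemma is_adjoint_0: "is_adjoint 0 0"
  by (simp add: is_adjoint_def cinner_def)

lemma adjoint_op_simps:
  "adjoint_op (proj m) = proj m"
  "adjoint_op 0 = 0"
  "A \<in> clinear_ops \<Longrightarrow> B \<in> clinear_ops \<Longrightarrow> adjoint_op (A + B) = adjoint_op A + adjoint_op B"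
  "A \<in> clinear_ops \<Longrightarrow> B \<in> clinear_ops \<Longrightarrow> adjoint_op (A o\<^sub>L B) = adjoint_op B o\<^sub>L adjoint_op A"
  "A \<in> clinear_ops \<Longrightarrow> adjoint_op (op_cscale c A) = op_cscale (cnj c) (adjoint_op A)"
  by (auto intro!: adjoint_op_eq is_adjoint_proj is_adjoint_0 is_adjoint_add is_adjoint_compose
      is_adjoint_op_cscale is_adjoint_adjoint_op)

lemma adjoint_op_diff:
  assumes "A \<in> clinear_ops" "B \<in> clinear_ops"
  shows "adjoint_op (A - B) = adjoint_op A - adjoint_op B"
  using adjoint_op_simps(3)[of "A - B" B] assms by (simp add: clinear_ops_closed_ops)

lemma continuous_on_op_cscale: "continuous_on X (op_cscale c)"
proof -
  have "op_cscale c = (\<lambda>A. op_cscale c id_blinfun o\<^sub>L A)"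
    by (intro ext blinfun_eqI) (simp add: op_cscale_apply)
  moreover have "continuous_on X (\<lambda>A. op_cscale c id_blinfun o\<^sub>L A)"
    by (intro bounded_bilinear.continuous_on[OF bounded_bilinear_blinfun_compose]
        continuous_on_const continuous_on_id)
  ultimately show ?thesis by simp
qed

lemma closed_clinear_ops: "closed clinear_ops"
proof -
  have eq: "clinear_ops = (\<Inter>c x. {A. blinfun_apply A (cscale c x) = blinfun_apply (op_cscale c A) x})"
    by (auto simp: clinear_ops_def op_cscale_apply)
  have "closed {A. blinfun_apply A (cscale c x) = blinfun_apply (op_cscale c A) x}" for c x
    by (intro closed_Collect_eq continuous_intros continuous_on_op_cscale)
  then show ?thesis
    unfolding eq by (intro closed_INT ballI)
qed

text \<open>On words, the adjoint deletes a final digit \<open>i\<close>: pairing with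
  \<open>unit_vec r\<close> becomes pairing with its image \<open>unit_vec (r * N + i)\<close> under
  the isometry.\<close>

lemma coord_adjoint_cuntz_iso:
  assumes "i < N"
  shows "coord (blinfun_apply (adjoint_op (cuntz_iso N i)) x) r = coord x (r * N + i)"
proof -
  have "blinfun_apply (cuntz_iso N i) (unit_vec r) = unit_vec (r * N + i)"
    using assms by (auto intro!: ell2_eqI simp: coord_cuntz_iso coord_unit_vec)
  moreover have "is_adjoint (cuntz_iso N i) (adjoint_op (cuntz_iso N i))"
    by (intro is_adjoint_adjoint_op clinear_ops_closed_ops)
  ultimately have "cinner (unit_vec (r * N + i)) x = cinner (unit_vec r) (blinfun_apply (adjoint_op (cuntz_iso N i)) x)"
    unfolding is_adjoint_def by metis
  then show ?thesis
    by (simp add: cinner_unit_vec)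
qed

lemma norm_sq_sum_unit_vec:
  assumes "finite T" "inj_on \<phi> T"
  shows "(norm (\<Sum>t\<in>T. cscale (c t) (unit_vec (\<phi> t))))\<^sup>2 = (\<Sum>t\<in>T. (cmod (c t))\<^sup>2)"
proof -
  have norm_unit: "norm (unit_vec k) = 1" for k
  proof -
    have "(norm (unit_vec k))\<^sup>2 = 1"
      unfolding norm_ell2_sq by (subst suminf_finite[of "{k}"]) (auto simp: coord_unit_vec)
    then show ?thesis using norm_ge_zero[of "unit_vec k"] by (auto simp: power2_eq_1_iff)
  qed
  have "(norm (\<Sum>t\<in>T. cscale (c t) (unit_vec (\<phi> t))))\<^sup>2 = (\<Sum>t\<in>T. (norm (cscale (c t) (unit_vec (\<phi> t))))\<^sup>2)"
    using assms
    by (intro norm_sum_Pythagorean)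
      (auto simp: pairwise_def orthogonal_def Re_cinner[symmetric] cinner_unit_vec coord_unit_vec inj_on_eq_iff)
  then show ?thesis by (simp add: norm_unit)
qed

section \<open>Digit expansions and the embeddings\<close>

definition digits :: "nat \<Rightarrow> nat \<Rightarrow> nat"
  where "digits N r = (LEAST k. r < N ^ k)"

text \<open>All bounds on word lengths are translated through this equivalence. The inequality
  \<open>r < N ^ r\<close> shows that the least exponent in \<open>digits\<close> exists.\<close>

lemma digits_le_iff:
  assumes "N \<ge> 2"
  shows "digits N r \<le> k \<longleftrightarrow> r < N ^ k"
proof
  have "r < N ^ r" using assms by (intro power_gt_expt) simp
  then have "r < N ^ digits N r" unfolding digits_def by (rule LeastI)
  moreover assume "digits N r \<le> k"
  then have "N ^ digits N r \<le> N ^ k" using assms by (intro power_increasing) simp_all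
  ultimately show "r < N ^ k" by simp
next
  assume "r < N ^ k"
  then show "digits N r \<le> k" unfolding digits_def by (rule Least_le)
qed

lemma mult_add_less_power_iff:
  fixes q r i N k :: nat
  assumes "i < N"
  shows "r * N + i < N ^ Suc k \<longleftrightarrow> r < N ^ k"
proof
  assume "r < N ^ k"
  then have "(r + 1) * N \<le> N ^ k * N" by (intro mult_right_mono) simp_all
  then show "r * N + i < N ^ Suc k" using assms by (simp add: algebra_simps)
next
  assume "r * N + i < N ^ Suc k"
  then have "r * N < N ^ k * N" by (metis add_lessD1 power_Suc2)
  then show "r < N ^ k" by (metis mult_less_cancel2)
qed

lemma digits_0 [simp]: "digits N 0 = 0"
  unfolding digits_def by (rule Least_equality) simp_all

text \<open>Appending a digit shifts every upper bound for the length by one, and the upper bounds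
  determine the length. The value 0 is excluded because it is the empty word, which stays empty when
  0 is appended.\<close>

lemma digits_mult_add:
  assumes "N \<ge> 2" "i < N" "r * N + i \<noteq> 0"
  shows "digits N (r * N + i) = Suc (digits N r)"
proof -
  have "digits N (r * N + i) \<noteq> 0"
    using digits_le_iff[OF assms(1), of "r * N + i" 0] assms(3) by simp
  then obtain d where d: "digits N (r * N + i) = Suc d" by (metis not0_implies_Suc)
  have "d \<le> k \<longleftrightarrow> digits N r \<le> k" for k
    using digits_le_iff[OF assms(1)] mult_add_less_power_iff[OF assms(2), of r k] d
    by (metis Suc_le_mono)
  then show ?thesis using d by (metis order_antisym order_refl)
qed

section \<open>Padding weights\<close>

text \<open>With t = l / n, this is (1 - t) times the uniform unit vector on the n positions
  following l, plus t times the unit vector at l + n + 1. It is uniform for l = 0 and sits at 2 n +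
  1 alone for l = n.\<close>

definition weight :: "nat \<Rightarrow> nat \<Rightarrow> nat \<Rightarrow> real"
  where "weight n l k =
    (if l < k \<and> k \<le> l + n then (1 - l / n) / sqrt n else if k = l + n + 1 then l / n else 0)"

lemma weight_eq_0: "k \<le> l \<Longrightarrow> weight n l k = 0"
  by (simp add: weight_def)

lemma weight_top: "n > 0 \<Longrightarrow> k \<le> 2 * n \<Longrightarrow> weight n n k = 0"
  by (simp add: weight_def)

lemma weight_eq_0_above: "l + n + 1 < k \<Longrightarrow> weight n l k = 0"
  by (simp add: weight_def)

lemma sum_weight_sq:
  assumes "n > 0" "l \<le> n"
  shows "(\<Sum>k\<le>2 * n + 1. (weight n l k)\<^sup>2) = (1 - l / n)\<^sup>2 + (l / n)\<^sup>2"
proof -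
  have "(\<Sum>k\<le>2 * n + 1. (weight n l k)\<^sup>2)
      = (\<Sum>k\<in>{l<..l + n} \<union> {l + n + 1}. (weight n l k)\<^sup>2)"
    using assms(2) by (intro sum.mono_neutral_right) (auto simp: weight_def)
  also have "\<dots> = (\<Sum>k\<in>{l<..l + n}. (weight n l k)\<^sup>2) + (l / n)\<^sup>2"
    by (subst sum.union_disjoint) (auto simp: weight_def)
  also have "(\<Sum>k\<in>{l<..l + n}. (weight n l k)\<^sup>2) = (\<Sum>k\<in>{l<..l + n}. (1 - l / n)\<^sup>2 / n)"
    by (intro sum.cong) (auto simp: weight_def power_divide)
  finally show ?thesis using assms(1) by simp
qed

lemma sum_weight_sq_bounds:
  assumes "n > 0" "l \<le> n"
  shows "(\<Sum>k\<le>2 * n + 1. (weight n l k)\<^sup>2) \<le> 1"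
    and "1 / 2 \<le> (\<Sum>k\<le>2 * n + 1. (weight n l k)\<^sup>2)"
proof -
  define t where "t = l / real n"
  have t: "0 \<le> t" "t \<le> 1" using assms by (simp_all add: t_def)
  have "t * t \<le> t * 1" using t by (intro mult_left_mono)
  then have "(1 - t)\<^sup>2 + t\<^sup>2 \<le> 1" by (simp add: power2_eq_square algebra_simps)
  \<comment> \<open>The minimum 1 / 2 of the squared norm is reached halfway, at t = 1 / 2.\<close>
  moreover have "0 \<le> (2 * t - 1)\<^sup>2" by simp
  then have "1 / 2 \<le> (1 - t)\<^sup>2 + t\<^sup>2" by (simp add: power2_eq_square algebra_simps)
  ultimately show "(\<Sum>k\<le>2 * n + 1. (weight n l k)\<^sup>2) \<le> 1"
    "1 / 2 \<le> (\<Sum>k\<le>2 * n + 1. (weight n l k)\<^sup>2)"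
    using sum_weight_sq[OF assms] by (simp_all add: t_def)
qed

text \<open>When word and padding both grow by one digit, the window moves along and only the
  heights change: by 1 / (n sqrt n) at n positions and by 1 / n at one more, which adds up to 2 /
  n^2.\<close>

lemma sum_weight_diff_sq:
  assumes "n > 0" "l < n"
  shows "(\<Sum>k\<le>2 * n. (weight n l k - weight n (Suc l) (Suc k))\<^sup>2) \<le> 2 / n"
proof -
  have eq: "(weight n l k - weight n (Suc l) (Suc k))\<^sup>2
      = (if l < k \<and> k \<le> l + n then 1 / n ^ 3 else if k = l + n + 1 then 1 / n ^ 2 else 0)" for k
  proof -
    have "(1 - real l / n) / sqrt n - (1 - real (Suc l) / n) / sqrt n = 1 / (n * sqrt n)"
      using assms by (simp add: field_simps)
    moreover have "(1 / (real n * sqrt n))\<^sup>2 = 1 / n ^ 3"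
      by (simp add: power_divide power_mult_distrib power3_eq_cube power2_eq_square)
    moreover have "real l / n - real (Suc l) / n = - (1 / n)"
      using assms by (simp add: field_simps)
    ultimately show ?thesis
      by (auto simp: weight_def power_divide)
  qed
  have "(\<Sum>k\<le>2 * n. (weight n l k - weight n (Suc l) (Suc k))\<^sup>2)
      = (\<Sum>k\<in>{l<..l + n} \<union> {l + n + 1}. if k \<le> l + n then 1 / real n ^ 3 else 1 / n ^ 2)"
    unfolding eq using assms(2) by (intro sum.mono_neutral_cong_right) auto
  also have "\<dots> = n * (1 / n ^ 3) + 1 / n ^ 2"
    by (subst sum.union_disjoint) auto
  also have "\<dots> = 2 / real n * (1 / real n)"
    using assms(1) by (simp add: power3_eq_cube power2_eq_square)
  \<comment> \<open>Weakened to the rate of the case l = 0, so that both cases share one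
    bound.\<close>
  also have "\<dots> \<le> 2 / n * 1"
    using assms(1) by (intro mult_left_mono) simp_all
  finally show ?thesis by simp
qed

text \<open>This is the case of the word 0, fixed by the isometry for the digit 0: the padding grows
  but the word does not, so the uniform window slides against itself. Only its two ends contribute,
  with 1 / n each; averaging over n paddings makes this small.\<close>

lemma sum_weight_0_diff_sq:
  assumes "n > 0"
  shows "(\<Sum>k\<le>2 * n. (weight n 0 k - weight n 0 (Suc k))\<^sup>2) \<le> 2 / n"
proof -
  have "(\<Sum>k\<le>2 * n. (weight n 0 k - weight n 0 (Suc k))\<^sup>2)
      = (\<Sum>k\<in>{0, n}. (weight n 0 k - weight n 0 (Suc k))\<^sup>2)"
    by (intro sum.mono_neutral_right) (auto simp: weight_def)
  also have "\<dots> = 2 / n"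
    using assms by (simp add: weight_def power_divide)
  finally show ?thesis by simp
qed

lemma sum_weight_digits_diff_sq:
  assumes "N \<ge> 2" "n > 0" "i < N" "r * N + i < N ^ n"
  shows "(\<Sum>k\<le>2 * n. (weight n (digits N r) k - weight n (digits N (r * N + i)) (Suc k))\<^sup>2) \<le> 2 / n"
proof (cases "r * N + i = 0")
  case True
  then show ?thesis using sum_weight_0_diff_sq[OF assms(2)] assms(1) by simp
next
  case False
  have "digits N (r * N + i) \<le> n" using assms by (simp add: digits_le_iff)
  then show ?thesis
    using sum_weight_diff_sq[OF assms(2), of "digits N r"]
    by (simp add: digits_mult_add[OF assms(1,3) False])
qed

text \<open>\<open>r + v * N ^ k\<close> prepends the digits of \<open>v\<close> to \<open>r\<close>, padded with zeros to \<open>k\<close> digits.\<close>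

lemma tagged_less_power_iff:
  fixes v r k m l N :: nat
  assumes "N \<ge> 2" "N ^ m \<le> v" "v < N ^ Suc m" "r < N ^ k"
  shows "r + v * N ^ k < N ^ l \<longleftrightarrow> m + k < l"
proof
  assume "m + k < l"
  have "r + v * N ^ k < (v + 1) * N ^ k" using assms(4) by simp
  also have "\<dots> \<le> N ^ Suc m * N ^ k" using assms(3) by (intro mult_right_mono) simp_all
  also have "\<dots> = N ^ (Suc (m + k))" by (simp add: power_add)
  also have "\<dots> \<le> N ^ l" using \<open>m + k < l\<close> assms(1) by (intro power_increasing) simp_all
  finally show "r + v * N ^ k < N ^ l" .
next
  assume "r + v * N ^ k < N ^ l"
  moreover have "N ^ (m + k) \<le> r + v * N ^ k"
    unfolding power_add using mult_right_mono[OF assms(2), of "N ^ k"] by (rule trans_le_add2) simp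
  ultimately have "N ^ (m + k) < N ^ l" by linarith
  then show "m + k < l" using assms(1) by (simp add: power_strict_increasing_iff)
qed

text \<open>By \<open>tagged_less_power_iff\<close> the number has exactly m + 1 + k digits, which
  reveals k. Division by \<open>N ^ k\<close> then separates the tag from \<open>r\<close>.\<close>

lemma tagged_inject:
  fixes v v' r r' k k' m N :: nat
  assumes "N \<ge> 2" "N ^ m \<le> v" "v < N ^ Suc m" "r < N ^ k"
    and "N ^ m \<le> v'" "v' < N ^ Suc m" "r' < N ^ k'"
    and eq: "r + v * N ^ k = r' + v' * N ^ k'"
  shows "v = v' \<and> r = r' \<and> k = k'"
proof -
  have "m + k < l \<longleftrightarrow> m + k' < l" for l
    using tagged_less_power_iff[OF assms(1-4), of l] tagged_less_power_iff[OF assms(1,5-7), of l] eq by simp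
  then have k: "k = k'" by (metis add_left_cancel less_antisym less_irrefl not_less_eq)
  have "(r + v * N ^ k) div N ^ k = v" "(r' + v' * N ^ k) div N ^ k = v'"
    using assms(4,7) k by (metis add.right_neutral div_less div_mult_self1 less_nat_zero_code neq0_conv add.left_neutral)+
  then have "v = v'" using eq k by metis
  then show ?thesis using eq k by simp
qed

section \<open>The embeddings and their norms\<close>

text \<open>The bound 2 n + 1 on the padding is the last position of nonzero weight for words of at
  most n digits.\<close>

definition embed :: "nat \<Rightarrow> nat \<Rightarrow> nat \<Rightarrow> ell2 \<Rightarrow> ell2"
  where "embed N n v x = (\<Sum>r<N ^ n. cscale (coord x r)
    (\<Sum>k\<le>2 * n + 1. cscale (weight n (digits N r) k) (unit_vec (r + v * N ^ k))))"

lemma embed_add: "embed N n v (x + y) = embed N n v x + embed N n v y"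
  by (simp add: embed_def ell2.scale_left_distrib sum.distrib)

lemma embed_cscale: "embed N n v (cscale c x) = cscale c (embed N n v x)"
  by (simp add: embed_def ell2.scale_sum_right)

lemma embed_0: "embed N n v 0 = 0"
  by (simp add: embed_def)

lemma embed_diff: "embed N n v (x - y) = embed N n v x - embed N n v y"
  by (simp add: embed_def ell2.scale_left_diff_distrib sum_subtractf)

lemma embed_sum: "embed N n v (sum f I) = (\<Sum>i\<in>I. embed N n v (f i))"
  by (induction I rule: infinite_finite_induct) (simp_all add: embed_0 embed_add)

lemma embed_unit_vec:
  "embed N n v (unit_vec r) = (if r < N ^ n
    then \<Sum>k\<le>2 * n + 1. cscale (weight n (digits N r) k) (unit_vec (r + v * N ^ k)) else 0)"
  by (simp add: embed_def coord_unit_vec if_distrib[of "\<lambda>c. cscale c _"] cong: if_cong)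

lemma embed_eq_sum: "embed N n v x = (\<Sum>r<N ^ n. cscale (coord x r) (embed N n v (unit_vec r)))"
  by (simp add: embed_unit_vec, simp add: embed_def)

text \<open>The longest words produced have m + 1 digits of the tag and 2 n + 1 further digits, so
  they just fit into level m + 2 n + 2.\<close>

lemma proj_embed:
  assumes "N \<ge> 2" "N ^ m \<le> v" "v < N ^ Suc m"
  shows "blinfun_apply (proj (N ^ (m + 2 * n + 2))) (embed N n v x) = embed N n v x"
proof -
  have "cscale (weight n (digits N r) k) (blinfun_apply (proj (N ^ (m + 2 * n + 2))) (unit_vec (r + v * N ^ k)))
      = cscale (weight n (digits N r) k) (unit_vec (r + v * N ^ k))" if "k \<le> 2 * n + 1" for r k
  proof (cases "digits N r \<le> k")
    case True
    then have "r + v * N ^ k < N ^ (m + 2 * n + 2)"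
      using that by (subst tagged_less_power_iff[OF assms]) (simp_all add: digits_le_iff assms(1))
    then have "blinfun_apply (proj (N ^ (m + 2 * n + 2))) (unit_vec (r + v * N ^ k)) = unit_vec (r + v * N ^ k)"
      by (intro ell2_eqI) (simp add: coord_proj coord_unit_vec)
    then show ?thesis by simp
  qed (simp add: weight_eq_0)
  then have "(\<Sum>k\<le>2 * n + 1. cscale (weight n (digits N r) k)
        (blinfun_apply (proj (N ^ (m + 2 * n + 2))) (unit_vec (r + v * N ^ k))))
      = (\<Sum>k\<le>2 * n + 1. cscale (weight n (digits N r) k) (unit_vec (r + v * N ^ k)))" for r
    by (intro sum.cong refl) (simp only: atMost_iff)
  then show ?thesis
    unfolding embed_def blinfun.sum_right clinear_opsD[OF clinear_ops_closed_ops(3)] by (simp only:)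
qed

text \<open>Pythagoras for a double sum. Injectivity is asked only where the coefficient is nonzero,
  since tagged words can be decoded only when the padding covers the digits of \<open>r\<close>, and
  this is where the weights are supported.\<close>

lemma norm_sq_double_sum_unit_vec:
  assumes "finite I" "finite J"
    and inj: "inj_on \<phi> {(i, j). i \<in> I \<and> j \<in> J \<and> c i j \<noteq> 0}"
  shows "(norm (\<Sum>i\<in>I. cscale (a i) (\<Sum>j\<in>J. cscale (c i j) (unit_vec (\<phi> (i, j))))))\<^sup>2
    = (\<Sum>i\<in>I. (cmod (a i))\<^sup>2 * (\<Sum>j\<in>J. (cmod (c i j))\<^sup>2))"
proof -
  define T where "T = {(i, j). i \<in> I \<and> j \<in> J \<and> c i j \<noteq> 0}"
  have T: "T \<subseteq> I \<times> J" by (auto simp: T_def)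
  then have fin: "finite T" using assms(1,2) by (meson finite_SigmaI finite_subset)
  have "(\<Sum>i\<in>I. cscale (a i) (\<Sum>j\<in>J. cscale (c i j) (unit_vec (\<phi> (i, j)))))
      = (\<Sum>(i, j)\<in>I \<times> J. cscale (a i * c i j) (unit_vec (\<phi> (i, j))))"
    by (simp add: ell2.scale_sum_right sum.cartesian_product)
  also have "\<dots> = (\<Sum>t\<in>T. cscale (a (fst t) * c (fst t) (snd t)) (unit_vec (\<phi> t)))"
    using assms(1,2) by (intro sum.mono_neutral_cong_right) (auto simp: T_def)
  finally have "(norm (\<Sum>i\<in>I. cscale (a i) (\<Sum>j\<in>J. cscale (c i j) (unit_vec (\<phi> (i, j))))))\<^sup>2
      = (\<Sum>t\<in>T. (cmod (a (fst t) * c (fst t) (snd t)))\<^sup>2)"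
    using norm_sq_sum_unit_vec[OF fin inj[folded T_def]] by simp
  also have "\<dots> = (\<Sum>(i, j)\<in>I \<times> J. (cmod (a i))\<^sup>2 * (cmod (c i j))\<^sup>2)"
    using assms(1,2) by (intro sum.mono_neutral_cong_left)
      (auto simp: T_def norm_mult power_mult_distrib)
  also have "\<dots> = (\<Sum>i\<in>I. (cmod (a i))\<^sup>2 * (\<Sum>j\<in>J. (cmod (c i j))\<^sup>2))"
    by (simp add: sum_distrib_left sum.cartesian_product)
  finally show ?thesis .
qed

lemma sum_coord_sq_le: "(\<Sum>r<m. (cmod (coord x r))\<^sup>2) \<le> (norm x)\<^sup>2"
  unfolding norm_ell2_sq by (intro sum_le_suminf) simp_all

text \<open>The images of different basis vectors have disjoint supports, so a uniform bound on the
  columns is already a bound on the operator norm.\<close>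

lemma norm_double_sum_unit_vec_le:
  assumes "finite J" "\<And>r. r < m \<Longrightarrow> (\<Sum>j\<in>J. (cmod (c r j))\<^sup>2) \<le> \<eta>\<^sup>2" "\<eta> \<ge> 0"
    and inj: "inj_on \<phi> {(r, j). r < m \<and> j \<in> J \<and> c r j \<noteq> 0}"
  shows "norm (\<Sum>r<m. cscale (coord x r) (\<Sum>j\<in>J. cscale (c r j) (unit_vec (\<phi> (r, j))))) \<le> \<eta> * norm x"
    (is "norm ?y \<le> _")
proof (rule power2_le_imp_le)
  have "(norm ?y)\<^sup>2 = (\<Sum>r<m. (cmod (coord x r))\<^sup>2 * (\<Sum>j\<in>J. (cmod (c r j))\<^sup>2))"
    using inj by (intro norm_sq_double_sum_unit_vec) (simp_all add: assms(1))
  also have "\<dots> \<le> (\<Sum>r<m. (cmod (coord x r))\<^sup>2 * \<eta>\<^sup>2)"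
    using assms(2) by (intro sum_mono mult_left_mono) simp_all
  also have "\<dots> \<le> (\<eta> * norm x)\<^sup>2"
    unfolding sum_distrib_right[symmetric]
    using mult_right_mono[OF sum_coord_sq_le[of x m], of "\<eta>\<^sup>2"] by (simp add: power_mult_distrib mult.commute)
  finally show "(norm ?y)\<^sup>2 \<le> (\<eta> * norm x)\<^sup>2" .
qed (simp add: assms(3))

lemma norm_embed_le:
  assumes "N \<ge> 2" "N ^ m \<le> v" "v < N ^ Suc m" "n > 0"
  shows "norm (embed N n v x) \<le> norm x"
proof -
  have "norm (\<Sum>r<N ^ n. cscale (coord x r) (\<Sum>k\<in>{..2 * n + 1}.
      cscale (weight n (digits N r) k) (unit_vec ((\<lambda>(r, k). r + v * N ^ k) (r, k))))) \<le> 1 * norm x"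
  proof (rule norm_double_sum_unit_vec_le)
    show "inj_on (\<lambda>(r, k). r + v * N ^ k)
      {(r, k). r < N ^ n \<and> k \<in> {..2 * n + 1} \<and> complex_of_real (weight n (digits N r) k) \<noteq> 0}"
    proof (rule inj_onI, clarsimp)
      fix r k r' k'
      assume "weight n (digits N r) k \<noteq> 0" "weight n (digits N r') k' \<noteq> 0"
        and eq: "r + v * N ^ k = r' + v * N ^ k'"
      \<comment> \<open>A nonzero weight forces the padding past the digits, which gives the bounds
        \<open>r < N ^ k\<close> needed for decoding.\<close>
      then have "digits N r \<le> k" "digits N r' \<le> k'"
        by (meson nle_le weight_eq_0)+
      then show "r = r' \<and> k = k'"
        using tagged_inject[OF assms(1-3) _ assms(2,3) _ eq] by (simp add: digits_le_iff assms(1))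
    qed
    fix r assume "r < N ^ n"
    then show "(\<Sum>k\<in>{..2 * n + 1}. (cmod (complex_of_real (weight n (digits N r) k)))\<^sup>2) \<le> 1\<^sup>2"
      using sum_weight_sq_bounds(1)[OF assms(4), of "digits N r"] by (simp add: digits_le_iff assms(1))
  qed simp_all
  then show ?thesis by (simp add: embed_def)
qed

text \<open>Copies with different tags have disjoint supports, and each copy keeps at least half of
  the squared norm of the first \<open>N ^ n\<close> coordinates because the squared weights sum to
  at least 1 / 2.\<close>

lemma norm_sum_embed_ge:
  assumes "N \<ge> 2" "finite V" "\<And>v. v \<in> V \<Longrightarrow> N ^ m \<le> v \<and> v < N ^ Suc m" "n > 0"
  shows "(\<Sum>v\<in>V. (cmod (a v))\<^sup>2) * (norm (blinfun_apply (proj (N ^ n)) x))\<^sup>2 / 2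
    \<le> (norm (\<Sum>v\<in>V. cscale (a v) (embed N n v x)))\<^sup>2"
proof -
  let ?J = "{..<N ^ n} \<times> {..2 * n + 1}"
  let ?c = "\<lambda>v (r, k). coord x r * complex_of_real (weight n (digits N r) k)"
  let ?\<phi> = "\<lambda>(v, r, k). r + v * N ^ k"
  have "embed N n v x = (\<Sum>j\<in>?J. cscale (?c v j) (unit_vec (?\<phi> (v, j))))" for v
    by (simp add: embed_def ell2.scale_sum_right sum.cartesian_product case_prod_unfold del: sum.atMost_Suc)
  then have "(norm (\<Sum>v\<in>V. cscale (a v) (embed N n v x)))\<^sup>2
    = (norm (\<Sum>v\<in>V. cscale (a v) (\<Sum>j\<in>?J. cscale (?c v j) (unit_vec (?\<phi> (v, j))))))\<^sup>2"
    by (simp only:)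
  also have "\<dots> = (\<Sum>v\<in>V. (cmod (a v))\<^sup>2 * (\<Sum>j\<in>?J. (cmod (?c v j))\<^sup>2))"
  proof (rule norm_sq_double_sum_unit_vec)
    show "inj_on ?\<phi> {(v, j). v \<in> V \<and> j \<in> ?J \<and> ?c v j \<noteq> 0}"
    proof (rule inj_onI, clarsimp)
      fix v r k v' r' k'
      assume V: "v \<in> V" "v' \<in> V"
        and "weight n (digits N r) k \<noteq> 0" "weight n (digits N r') k' \<noteq> 0"
        and eq: "r + v * N ^ k = r' + v' * N ^ k'"
      then have "digits N r \<le> k" "digits N r' \<le> k'"
        by (meson nle_le weight_eq_0)+
      then show "v = v' \<and> r = r' \<and> k = k'"
        using tagged_inject[OF assms(1) _ _ _ _ _ _ eq, of m] assms(3)[OF V(1)] assms(3)[OF V(2)]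
        by (simp add: digits_le_iff assms(1))
    qed
  qed (simp_all add: assms(2))
  also have "(\<Sum>v\<in>V. (cmod (a v))\<^sup>2 * (\<Sum>j\<in>?J. (cmod (?c v j))\<^sup>2))
      \<ge> (\<Sum>v\<in>V. (cmod (a v))\<^sup>2 * ((norm (blinfun_apply (proj (N ^ n)) x))\<^sup>2 / 2))"
  proof (intro sum_mono mult_left_mono)
    fix v
    have "(norm (blinfun_apply (proj (N ^ n)) x))\<^sup>2 = (\<Sum>r<N ^ n. (cmod (coord x r))\<^sup>2)"
      unfolding proj_eq_sum by (rule norm_sq_sum_unit_vec[where \<phi> = id, simplified]) simp_all
    then have "(norm (blinfun_apply (proj (N ^ n)) x))\<^sup>2 / 2 = (\<Sum>r<N ^ n. (cmod (coord x r))\<^sup>2 * (1 / 2))"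
      by (simp add: sum_divide_distrib)
    also have "\<dots> \<le> (\<Sum>r<N ^ n. (cmod (coord x r))\<^sup>2 * (\<Sum>k\<le>2 * n + 1. (weight n (digits N r) k)\<^sup>2))"
      using sum_weight_sq_bounds(2)[OF assms(4)]
      by (intro sum_mono mult_left_mono) (simp_all add: digits_le_iff assms(1))
    also have "\<dots> = (\<Sum>j\<in>?J. (cmod (?c v j))\<^sup>2)"
      by (simp add: sum_distrib_left sum.cartesian_product case_prod_unfold norm_mult power_mult_distrib
          del: sum.atMost_Suc)
    finally show "(norm (blinfun_apply (proj (N ^ n)) x))\<^sup>2 / 2 \<le> (\<Sum>j\<in>?J. (cmod (?c v j))\<^sup>2)" .
  qed simp
  finally show ?thesis
    by (simp only: sum_distrib_right sum_divide_distrib times_divide_eq_right)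
qed

section \<open>Intertwined sequences\<close>

lemma blinfun_compose_assoc: "(A o\<^sub>L B) o\<^sub>L C = A o\<^sub>L (B o\<^sub>L C)"
  by (intro blinfun_eqI) simp

lemma proj_proj [simp]: "proj m o\<^sub>L proj m = proj m"
  by (intro blinfun_eqI ell2_eqI) (simp add: coord_proj)

lemma matrix_ops_iff:
  "A \<in> matrix_ops m \<longleftrightarrow> A \<in> clinear_ops \<and> proj m o\<^sub>L A = A \<and> A o\<^sub>L proj m = A"
proof
  assume A: "A \<in> matrix_ops m"
  then have eq: "proj m o\<^sub>L A o\<^sub>L proj m = A" by (simp add: matrix_ops_def)
  have "proj m o\<^sub>L (proj m o\<^sub>L A o\<^sub>L proj m) = proj m o\<^sub>L A o\<^sub>L proj m"
    "(proj m o\<^sub>L A o\<^sub>L proj m) o\<^sub>L proj m = proj m o\<^sub>L A o\<^sub>L proj m"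
    by (intro blinfun_eqI ell2_eqI, simp add: coord_proj) (simp add: blinfun_compose_assoc)
  then show "A \<in> clinear_ops \<and> proj m o\<^sub>L A = A \<and> A o\<^sub>L proj m = A"
    using A by (simp add: eq matrix_ops_def)
qed (simp add: matrix_ops_def)

lemma matrix_ops_closed_ops:
  "0 \<in> matrix_ops m"
  "proj m \<in> matrix_ops m"
  "A \<in> clinear_ops \<Longrightarrow> proj m o\<^sub>L A o\<^sub>L proj m \<in> matrix_ops m"
  "A \<in> matrix_ops m \<Longrightarrow> B \<in> matrix_ops m \<Longrightarrow> A + B \<in> matrix_ops m"
  "A \<in> matrix_ops m \<Longrightarrow> B \<in> matrix_ops m \<Longrightarrow> A - B \<in> matrix_ops m"
  "A \<in> matrix_ops m \<Longrightarrow> B \<in> matrix_ops m \<Longrightarrow> A o\<^sub>L B \<in> matrix_ops m"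
  "A \<in> matrix_ops m \<Longrightarrow> op_cscale c A \<in> matrix_ops m"
  "A \<in> matrix_ops m \<Longrightarrow> adjoint_op A \<in> matrix_ops m"
proof -
  show "A o\<^sub>L B \<in> matrix_ops m" if "A \<in> matrix_ops m" "B \<in> matrix_ops m" for A B
  proof -
    have "proj m o\<^sub>L (A o\<^sub>L B) = (proj m o\<^sub>L A) o\<^sub>L B" by (simp only: blinfun_compose_assoc)
    moreover have "(A o\<^sub>L B) o\<^sub>L proj m = A o\<^sub>L (B o\<^sub>L proj m)" by (rule blinfun_compose_assoc)
    ultimately show ?thesis
      using that by (simp add: matrix_ops_iff clinear_ops_closed_ops)
  qed
  show "proj m o\<^sub>L A o\<^sub>L proj m \<in> matrix_ops m" if "A \<in> clinear_ops" for A
  proof -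
    have "proj m o\<^sub>L (proj m o\<^sub>L A o\<^sub>L proj m) = (proj m o\<^sub>L proj m) o\<^sub>L A o\<^sub>L proj m"
      by (simp only: blinfun_compose_assoc)
    then show ?thesis
      unfolding matrix_ops_iff using that by (simp add: clinear_ops_closed_ops blinfun_compose_assoc)
  qed
  show "op_cscale c A \<in> matrix_ops m" if A: "A \<in> matrix_ops m" for c A
  proof -
    have "proj m o\<^sub>L op_cscale c A = op_cscale c (proj m o\<^sub>L A)"
      "op_cscale c A o\<^sub>L proj m = op_cscale c (A o\<^sub>L proj m)"
      by (auto intro!: blinfun_eqI simp: op_cscale_apply clinear_opsD clinear_ops_closed_ops)
    then show ?thesis using A by (simp add: matrix_ops_iff clinear_ops_closed_ops)
  qed
  show "adjoint_op A \<in> matrix_ops m" if "A \<in> matrix_ops m" for A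
  proof -
    have A: "A \<in> clinear_ops" "proj m o\<^sub>L A = A" "A o\<^sub>L proj m = A"
      using that by (simp_all add: matrix_ops_iff)
    then show ?thesis
      using adjoint_op_simps(4)[OF clinear_ops_closed_ops(3) A(1), of m]
        adjoint_op_simps(4)[OF A(1) clinear_ops_closed_ops(3), of m]
      by (simp add: matrix_ops_iff adjoint_op_simps(1) adjoint_op_clinear)
  qed
qed (auto simp: matrix_ops_iff clinear_ops_closed_ops
    bounded_bilinear.add_left[OF bounded_bilinear_blinfun_compose]
    bounded_bilinear.add_right[OF bounded_bilinear_blinfun_compose]
    bounded_bilinear.diff_left[OF bounded_bilinear_blinfun_compose]
    bounded_bilinear.diff_right[OF bounded_bilinear_blinfun_compose])

lemma closed_matrix_ops: "closed (matrix_ops m)"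
proof -
  have "closed {A. proj m o\<^sub>L A o\<^sub>L proj m = A}"
    by (intro closed_Collect_eq bounded_bilinear.continuous_on[OF bounded_bilinear_blinfun_compose]
        continuous_on_const continuous_on_id)
  with closed_clinear_ops have "closed (clinear_ops \<inter> {A. proj m o\<^sub>L A o\<^sub>L proj m = A})"
    by (rule closed_Int)
  then show ?thesis by (simp add: matrix_ops_def Int_def)
qed

lemma F_eta_apply: "A \<in> F_eta N \<Longrightarrow> apply_bcontfun A n \<in> matrix_ops (N ^ n)"
  by (simp add: F_eta_def)

lemma F_eta_closed_ops:
  "0 \<in> F_eta N"
  "seq_one N \<in> F_eta N"
  "T \<in> clinear_ops \<Longrightarrow> truncations N T \<in> F_eta N"
  "A \<in> F_eta N \<Longrightarrow> B \<in> F_eta N \<Longrightarrow> A + B \<in> F_eta N"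
  "A \<in> F_eta N \<Longrightarrow> B \<in> F_eta N \<Longrightarrow> A - B \<in> F_eta N"
  "A \<in> F_eta N \<Longrightarrow> B \<in> F_eta N \<Longrightarrow> seq_mult A B \<in> F_eta N"
  "A \<in> F_eta N \<Longrightarrow> seq_cscale c A \<in> F_eta N"
  "A \<in> F_eta N \<Longrightarrow> seq_adjoint A \<in> F_eta N"
  by (auto simp: F_eta_def seq_one_apply truncations_apply seq_mult_apply seq_cscale_apply
      seq_adjoint_apply[of _ N] matrix_ops_closed_ops)

lemma closed_F_eta: "closed (F_eta N)"
proof -
  have eq: "F_eta N = (\<Inter>n. {A. apply_bcontfun A n \<in> matrix_ops (N ^ n)})"
    by (auto simp: F_eta_def)
  have "bounded_linear (\<lambda>A::op_seq. apply_bcontfun A n)" for n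
    by (rule bounded_linear_intro[where K = 1]) (simp_all add: norm_bounded)
  then have "closed {A::op_seq. apply_bcontfun A n \<in> matrix_ops (N ^ n)}" for n
    using closed_vimage[OF closed_matrix_ops] linear_continuous_on unfolding vimage_def by blast
  then show ?thesis
    unfolding eq by (intro closed_INT ballI)
qed

lemma F_eta_clinear: "A \<in> F_eta N \<Longrightarrow> apply_bcontfun A n \<in> clinear_ops"
  by (simp add: F_eta_def matrix_ops_iff)

lemma seq_adjoint_simps:
  assumes "A \<in> F_eta N"
  shows "B \<in> F_eta N \<Longrightarrow> seq_adjoint (A + B) = seq_adjoint A + seq_adjoint B"
    and "B \<in> F_eta N \<Longrightarrow> seq_adjoint (A - B) = seq_adjoint A - seq_adjoint B"
    and "B \<in> F_eta N \<Longrightarrow> seq_adjoint (seq_mult A B) = seq_mult (seq_adjoint B) (seq_adjoint A)"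
    and "seq_adjoint (seq_cscale c A) = seq_cscale (cnj c) (seq_adjoint A)"
    and "seq_adjoint (seq_adjoint A) = A"
  using assms
  by (auto intro!: bcontfun_eqI simp: seq_adjoint_apply[of _ N] F_eta_closed_ops seq_mult_apply
      seq_cscale_apply adjoint_op_simps adjoint_op_diff adjoint_op_adjoint_op F_eta_clinear)

lemma norm_seq_adjoint_le:
  assumes "A \<in> F_eta N"
  shows "norm (seq_adjoint A) \<le> norm A"
proof (rule norm_bound)
  fix n
  show "norm (seq_adjoint A n) \<le> norm A"
    using norm_adjoint_op_le[OF F_eta_clinear[OF assms], of n] norm_bounded[of A n]
    by (simp add: seq_adjoint_apply[OF assms])
qed

section \<open>The approximate intertwining relation\<close>

text \<open>The level m + 2 n + 2 is the greatest word length that \<open>embed N n v\<close>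
  produces. The threshold for n may depend on the tag length m but is uniform in the tag and the
  vector.\<close>

definition intertwined :: "nat \<Rightarrow> op_seq \<Rightarrow> bool"
  where "intertwined N A \<longleftrightarrow> (\<forall>m. \<forall>\<epsilon>>0. \<forall>\<^sub>F n in sequentially. \<forall>v x. N ^ m \<le> v \<longrightarrow> v < N ^ Suc m \<longrightarrow>
    norm (blinfun_apply (A (m + 2 * n + 2)) (embed N n v x) - embed N n v (blinfun_apply (A n) x))
      \<le> \<epsilon> * norm x)"

lemma intertwinedD:
  assumes "intertwined N A" "\<epsilon> > 0"
  shows "\<forall>\<^sub>F n in sequentially. \<forall>v x. N ^ m \<le> v \<longrightarrow> v < N ^ Suc m \<longrightarrow>
    norm (blinfun_apply (A (m + 2 * n + 2)) (embed N n v x) - embed N n v (blinfun_apply (A n) x))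
      \<le> \<epsilon> * norm x"
  using assms by (simp add: intertwined_def)

lemma intertwined_add:
  assumes "intertwined N A" "intertwined N B"
  shows "intertwined N (A + B)"
  unfolding intertwined_def
proof (intro allI impI)
  fix m and \<epsilon> :: real assume "\<epsilon> > 0"
  then have "\<epsilon> / 2 > 0" by simp
  from intertwinedD[OF assms(1) this, of m] intertwinedD[OF assms(2) this, of m]
  show "\<forall>\<^sub>F n in sequentially. \<forall>v x. N ^ m \<le> v \<longrightarrow> v < N ^ Suc m \<longrightarrow>
    norm (blinfun_apply ((A + B) (m + 2 * n + 2)) (embed N n v x)
      - embed N n v (blinfun_apply ((A + B) n) x)) \<le> \<epsilon> * norm x"
  proof eventually_elim
    case (elim n)
    show ?case
    proof (intro allI impI)
      fix v x assume "N ^ m \<le> v" "v < N ^ Suc m"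
      with elim have "norm (blinfun_apply (A (m + 2 * n + 2)) (embed N n v x) - embed N n v (blinfun_apply (A n) x))
          + norm (blinfun_apply (B (m + 2 * n + 2)) (embed N n v x) - embed N n v (blinfun_apply (B n) x))
          \<le> \<epsilon> / 2 * norm x + \<epsilon> / 2 * norm x" by (intro add_mono) blast+
      from order_trans[OF norm_triangle_ineq this]
      show "norm (blinfun_apply ((A + B) (m + 2 * n + 2)) (embed N n v x)
          - embed N n v (blinfun_apply ((A + B) n) x)) \<le> \<epsilon> * norm x"
        by (simp add: blinfun.add_left embed_add algebra_simps)
    qed
  qed
qed

text \<open>With V the embedding, the error of a product is A (B V - V B) + (A V - V A) B, where
  each factor is taken at its own level. Adding 1 to the norms keeps the denominators
  positive.\<close>

lemma intertwined_mult:
  assumes "N \<ge> 2" "intertwined N A" "intertwined N B"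
  shows "intertwined N (seq_mult A B)"
  unfolding intertwined_def
proof (intro allI impI)
  fix m and \<epsilon> :: real assume \<epsilon>: "\<epsilon> > 0"
  define a b where "a = norm A + 1" and "b = norm B + 1"
  have ab: "a > 0" "b > 0" by (simp_all add: a_def b_def add_nonneg_pos)
  have bounds: "norm (A k) \<le> a" "norm (B k) \<le> b" for k
    using norm_bounded[of A k] norm_bounded[of B k] by (simp_all add: a_def b_def)
  have "\<epsilon> / (2 * b) > 0" "\<epsilon> / (2 * a) > 0" using \<epsilon> ab by simp_all
  from intertwinedD[OF assms(2) this(1), of m] intertwinedD[OF assms(3) this(2), of m]
  show "\<forall>\<^sub>F n in sequentially. \<forall>v x. N ^ m \<le> v \<longrightarrow> v < N ^ Suc m \<longrightarrow>
    norm (blinfun_apply (seq_mult A B (m + 2 * n + 2)) (embed N n v x)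
      - embed N n v (blinfun_apply (seq_mult A B n) x)) \<le> \<epsilon> * norm x"
  proof eventually_elim
    case (elim n)
    show ?case
    proof (intro allI impI)
      fix v x assume v: "N ^ m \<le> v" "v < N ^ Suc m"
      let ?A = "A (m + 2 * n + 2)" and ?B = "B (m + 2 * n + 2)"
      let ?d = "blinfun_apply ?B (embed N n v x) - embed N n v (blinfun_apply (B n) x)"
      let ?e = "blinfun_apply ?A (embed N n v (blinfun_apply (B n) x))
        - embed N n v (blinfun_apply (A n) (blinfun_apply (B n) x))"
      have "norm (blinfun_apply ?A ?d) \<le> norm ?A * norm ?d" by (rule norm_blinfun)
      also have "\<dots> \<le> a * (\<epsilon> / (2 * a) * norm x)"
        using elim(2) v bounds ab by (intro mult_mono) auto
      finally have d: "norm (blinfun_apply ?A ?d) \<le> \<epsilon> / 2 * norm x" using ab by simp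
      have "norm ?e \<le> \<epsilon> / (2 * b) * norm (blinfun_apply (B n) x)" using elim(1) v by blast
      also have "\<dots> \<le> \<epsilon> / (2 * b) * (b * norm x)"
        using \<epsilon> ab order_trans[OF norm_blinfun mult_right_mono[OF bounds(2)]]
        by (intro mult_left_mono) auto
      finally have e: "norm ?e \<le> \<epsilon> / 2 * norm x" using ab by simp
      have "norm (blinfun_apply (seq_mult A B (m + 2 * n + 2)) (embed N n v x)
          - embed N n v (blinfun_apply (seq_mult A B n) x)) = norm (blinfun_apply ?A ?d + ?e)"
        by (simp add: seq_mult_apply blinfun.diff_right)
      also have "\<dots> \<le> \<epsilon> / 2 * norm x + \<epsilon> / 2 * norm x" by (rule norm_triangle_le[OF add_mono[OF d e]])
      finally show "norm (blinfun_apply (seq_mult A B (m + 2 * n + 2)) (embed N n v x)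
          - embed N n v (blinfun_apply (seq_mult A B n) x)) \<le> \<epsilon> * norm x"
        by (simp add: algebra_simps)
    qed
  qed
qed

lemma intertwined_cscale:
  assumes "intertwined N A"
  shows "intertwined N (seq_cscale c A)"
  unfolding intertwined_def
proof (intro allI impI)
  fix m and \<epsilon> :: real assume \<epsilon>: "\<epsilon> > 0"
  define a where "a = cmod c + 1"
  have a: "a > 0" by (simp add: a_def add_nonneg_pos)
  have "\<epsilon> / a > 0" using \<epsilon> a by simp
  from intertwinedD[OF assms this, of m]
  show "\<forall>\<^sub>F n in sequentially. \<forall>v x. N ^ m \<le> v \<longrightarrow> v < N ^ Suc m \<longrightarrow>
    norm (blinfun_apply (seq_cscale c A (m + 2 * n + 2)) (embed N n v x)
      - embed N n v (blinfun_apply (seq_cscale c A n) x)) \<le> \<epsilon> * norm x"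
  proof eventually_elim
    case (elim n)
    show ?case
    proof (intro allI impI)
      fix v x assume v: "N ^ m \<le> v" "v < N ^ Suc m"
      let ?d = "blinfun_apply (A (m + 2 * n + 2)) (embed N n v x) - embed N n v (blinfun_apply (A n) x)"
      have "norm (cscale c ?d) \<le> a * (\<epsilon> / a * norm x)"
        unfolding norm_cscale using elim v a by (intro mult_mono) (auto simp: a_def)
      then show "norm (blinfun_apply (seq_cscale c A (m + 2 * n + 2)) (embed N n v x)
          - embed N n v (blinfun_apply (seq_cscale c A n) x)) \<le> \<epsilon> * norm x"
        using a by (simp add: seq_cscale_apply op_cscale_apply embed_cscale ell2.scale_right_diff_distrib)
    qed
  qed
qed

text \<open>The error of A is (A - B) V + (B V - V B) - V (A - B). Each term gets a third of the
  tolerance, the last one because V is a contraction.\<close>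

lemma intertwined_closure:
  assumes "N \<ge> 2" "\<And>\<delta>. \<delta> > 0 \<Longrightarrow> \<exists>B. intertwined N B \<and> norm (A - B) \<le> \<delta>"
  shows "intertwined N A"
  unfolding intertwined_def
proof (intro allI impI)
  fix m and \<epsilon> :: real assume \<epsilon>: "\<epsilon> > 0"
  then have "\<epsilon> / 3 > 0" by simp
  with assms(2) obtain B where B: "intertwined N B" "norm (A - B) \<le> \<epsilon> / 3" by blast
  have AB: "norm (A k - B k) \<le> \<epsilon> / 3" for k
    using norm_bounded[of "A - B" k] B(2) by simp
  from intertwinedD[OF B(1) \<open>\<epsilon> / 3 > 0\<close>, of m] eventually_gt_at_top[of 0]
  show "\<forall>\<^sub>F n in sequentially. \<forall>v x. N ^ m \<le> v \<longrightarrow> v < N ^ Suc m \<longrightarrow>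
    norm (blinfun_apply (A (m + 2 * n + 2)) (embed N n v x)
      - embed N n v (blinfun_apply (A n) x)) \<le> \<epsilon> * norm x"
  proof eventually_elim
    case (elim n)
    show ?case
    proof (intro allI impI)
      fix v x assume v: "N ^ m \<le> v" "v < N ^ Suc m"
      let ?k = "m + 2 * n + 2"
      let ?V = "embed N n v"
      note V = norm_embed_le[OF assms(1) v elim(2)]
      have 1: "norm (blinfun_apply (A ?k - B ?k) (?V x)) \<le> \<epsilon> / 3 * norm x"
        by (rule order_trans[OF norm_blinfun mult_mono[OF AB V]]) (use \<epsilon> in simp_all)
      have 2: "norm (blinfun_apply (B ?k) (?V x) - ?V (blinfun_apply (B n) x)) \<le> \<epsilon> / 3 * norm x"
        using elim(1) v by blast
      have "norm (?V (blinfun_apply (A n - B n) x)) \<le> norm (blinfun_apply (A n - B n) x)" by (rule V)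
      also have "\<dots> \<le> \<epsilon> / 3 * norm x"
        by (rule order_trans[OF norm_blinfun mult_right_mono[OF AB]]) simp
      finally have 3: "norm (?V (blinfun_apply (A n - B n) x)) \<le> \<epsilon> / 3 * norm x" .
      have "blinfun_apply (A ?k) (?V x) - ?V (blinfun_apply (A n) x)
          = blinfun_apply (A ?k - B ?k) (?V x) + (blinfun_apply (B ?k) (?V x) - ?V (blinfun_apply (B n) x))
            - ?V (blinfun_apply (A n - B n) x)"
        by (simp add: blinfun.diff_left embed_diff)
      also have "norm \<dots> \<le> \<epsilon> / 3 * norm x + \<epsilon> / 3 * norm x + \<epsilon> / 3 * norm x"
        by (intro norm_triangle_le_diff norm_triangle_le add_mono 1 2 3)
      finally show "norm (blinfun_apply (A ?k) (?V x) - ?V (blinfun_apply (A n) x)) \<le> \<epsilon> * norm x"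
        by (simp add: algebra_simps)
    qed
  qed
qed

lemma intertwined_0: "intertwined N 0"
  by (simp add: intertwined_def embed_0)

text \<open>Taking adjoints in A V = V A yields a relation for the adjoint of V rather than for V.
  The condition on the adjoint sequence is therefore imposed separately, which makes the set closed
  under the involution.\<close>

definition intertwined_algebra :: "nat \<Rightarrow> op_seq set"
  where "intertwined_algebra N = {A \<in> F_eta N. intertwined N A \<and> intertwined N (seq_adjoint A)}"

lemma closed_intertwined_algebra:
  assumes "N \<ge> 2"
  shows "closed (intertwined_algebra N)"
proof -
  have "A \<in> intertwined_algebra N" if A: "A \<in> closure (intertwined_algebra N)" for A
  proof -
    have "intertwined_algebra N \<subseteq> F_eta N" by (auto simp: intertwined_algebra_def)
    then have F: "A \<in> F_eta N"
      using A closure_minimal closed_F_eta by blast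
    have ex: "\<exists>B\<in>intertwined_algebra N. norm (A - B) \<le> \<delta>" if "\<delta> > 0" for \<delta>
      using A that unfolding closure_approachable
      by (metis dist_commute dist_norm less_imp_le)
    have "intertwined N A"
      using ex by (intro intertwined_closure[OF assms]) (auto simp: intertwined_algebra_def)
    moreover have "intertwined N (seq_adjoint A)"
    proof (rule intertwined_closure[OF assms])
      fix \<delta> :: real assume "\<delta> > 0"
      then obtain B where B: "B \<in> intertwined_algebra N" "norm (A - B) \<le> \<delta>" using ex by blast
      then have "B \<in> F_eta N" by (simp add: intertwined_algebra_def)
      then have "norm (seq_adjoint A - seq_adjoint B) \<le> norm (A - B)"
        using norm_seq_adjoint_le[of "A - B" N] F by (simp add: seq_adjoint_simps F_eta_closed_ops)
      with B show "\<exists>B. intertwined N B \<and> norm (seq_adjoint A - B) \<le> \<delta>"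
        unfolding intertwined_algebra_def by (blast intro: order_trans)
    qed
    ultimately show ?thesis using F by (simp add: intertwined_algebra_def)
  qed
  then show ?thesis by (metis closure_subset_eq subsetI)
qed

lemma cstar_subalgebra_intertwined_algebra:
  assumes "N \<ge> 2"
  shows "cstar_subalgebra (F_eta N) seq_cscale seq_mult seq_adjoint (intertwined_algebra N)"
proof -
  have "seq_adjoint 0 = 0"
    using seq_adjoint_simps(2)[of 0 N 0] F_eta_closed_ops(1)[of N] by simp
  then show ?thesis
    unfolding cstar_subalgebra_def using closed_intertwined_algebra[OF assms]
    by (auto simp: intertwined_algebra_def F_eta_closed_ops seq_adjoint_simps[of _ N] intertwined_0
        intertwined_add intertwined_mult assms intertwined_cscale)
qed

section \<open>Intertwining of the truncated generators\<close>

lemma intertwining_error_eq_sum: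
  assumes "A \<in> F_eta N"
  shows "blinfun_apply (A k) (embed N n v x) - embed N n v (blinfun_apply (A n) x)
    = (\<Sum>r<N ^ n. cscale (coord x r)
        (blinfun_apply (A k) (embed N n v (unit_vec r)) - embed N n v (blinfun_apply (A n) (unit_vec r))))"
proof -
  note lin = clinear_opsD[OF F_eta_clinear[OF assms]]
  have "A n o\<^sub>L proj (N ^ n) = A n"
    using F_eta_apply[OF assms] by (simp add: matrix_ops_iff)
  then have "blinfun_apply (A n) x = blinfun_apply (A n) (blinfun_apply (proj (N ^ n)) x)"
    by (metis blinfun_apply_blinfun_compose)
  also have "\<dots> = (\<Sum>r<N ^ n. cscale (coord x r) (blinfun_apply (A n) (unit_vec r)))"
    by (simp add: proj_eq_sum blinfun.sum_right lin)
  finally show ?thesis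
    by (subst embed_eq_sum)
      (simp add: blinfun.sum_right lin embed_sum embed_cscale sum_subtractf ell2.scale_right_diff_distrib)
qed

text \<open>If the errors on the basis vectors are expanded in unit vectors that never repeat, then
  the column bound 2 / n on the squares gives an operator error of at most sqrt (2 / n), which tends
  to 0.\<close>

lemma intertwinedI:
  fixes c :: "nat \<Rightarrow> nat \<Rightarrow> nat \<Rightarrow> real"
  assumes "N \<ge> 2" "A \<in> F_eta N"
    and "\<And>n m v r. n > 0 \<Longrightarrow> N ^ m \<le> v \<Longrightarrow> v < N ^ Suc m \<Longrightarrow> r < N ^ n \<Longrightarrow>
      blinfun_apply (A (m + 2 * n + 2)) (embed N n v (unit_vec r)) - embed N n v (blinfun_apply (A n) (unit_vec r))
      = (\<Sum>k\<le>2 * n. cscale (of_real (c n r k)) (unit_vec (\<phi> v (r, k))))"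
    and "\<And>n r. n > 0 \<Longrightarrow> r < N ^ n \<Longrightarrow> (\<Sum>k\<le>2 * n. (c n r k)\<^sup>2) \<le> 2 / real n"
    and "\<And>n m v. n > 0 \<Longrightarrow> N ^ m \<le> v \<Longrightarrow> v < N ^ Suc m \<Longrightarrow>
      inj_on (\<phi> v) {(r, k). r < N ^ n \<and> k \<le> 2 * n \<and> c n r k \<noteq> 0}"
  shows "intertwined N A"
  unfolding intertwined_def
proof (intro allI impI)
  fix m and \<epsilon> :: real assume \<epsilon>: "\<epsilon> > 0"
  have "(\<lambda>n. sqrt (2 / real n)) \<longlonglongrightarrow> sqrt 0"
    by (intro tendsto_real_sqrt lim_const_over_n)
  then have "\<forall>\<^sub>F n in sequentially. sqrt (2 / real n) < \<epsilon>"
    using \<epsilon> by (intro order_tendstoD(2)) simp_all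
  with eventually_gt_at_top[of 0]
  show "\<forall>\<^sub>F n in sequentially. \<forall>v x. N ^ m \<le> v \<longrightarrow> v < N ^ Suc m \<longrightarrow>
    norm (blinfun_apply (A (m + 2 * n + 2)) (embed N n v x)
      - embed N n v (blinfun_apply (A n) x)) \<le> \<epsilon> * norm x"
  proof eventually_elim
    case (elim n)
    show ?case
    proof (intro allI impI)
      fix v x assume v: "N ^ m \<le> v" "v < N ^ Suc m"
      have "blinfun_apply (A (m + 2 * n + 2)) (embed N n v x) - embed N n v (blinfun_apply (A n) x)
          = (\<Sum>r<N ^ n. cscale (coord x r) (\<Sum>k\<in>{..2 * n}. cscale (of_real (c n r k)) (unit_vec (\<phi> v (r, k)))))"
        by (rule trans[OF intertwining_error_eq_sum[OF assms(2)] sum.cong[OF refl]])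
          (simp only: lessThan_iff assms(3)[OF elim(1) v])
      also have "norm \<dots> \<le> sqrt (2 / real n) * norm x"
        using assms(4)[OF elim(1)] assms(5)[OF elim(1) v]
        by (intro norm_double_sum_unit_vec_le) simp_all
      also have "\<dots> \<le> \<epsilon> * norm x" using elim(2) by (intro mult_right_mono) simp_all
      finally show "norm (blinfun_apply (A (m + 2 * n + 2)) (embed N n v x)
        - embed N n v (blinfun_apply (A n) x)) \<le> \<epsilon> * norm x" .
    qed
  qed
qed

lemma truncation_cuntz_iso_unit_vec:
  assumes "i < N"
  shows "blinfun_apply (truncations N (cuntz_iso N i) n) (unit_vec q)
    = (if q * N + i < N ^ n then unit_vec (q * N + i) else 0)"
proof (rule ell2_eqI)
  fix k
  have "q < N ^ n" if "q * N + i < N ^ n"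
  proof -
    have "q * 1 \<le> q * N" using assms by (intro mult_left_mono) simp_all
    then show ?thesis using that by linarith
  qed
  moreover have "k mod N = i \<and> k div N = q \<longleftrightarrow> k = q * N + i"
    using assms by (auto simp: div_mult_mod_eq)
  ultimately show "coord (blinfun_apply (truncations N (cuntz_iso N i) n) (unit_vec q)) k
    = coord (if q * N + i < N ^ n then unit_vec (q * N + i) else 0) k"
    using assms by (auto simp: truncations_apply coord_proj coord_cuntz_iso coord_unit_vec)
qed

lemma truncation_adjoint_cuntz_iso_unit_vec:
  assumes "i < N"
  shows "blinfun_apply (truncations N (adjoint_op (cuntz_iso N i)) n) (unit_vec q)
    = (if q < N ^ n \<and> q mod N = i then unit_vec (q div N) else 0)"
proof (rule ell2_eqI)
  fix k
  have "q div N < N ^ n" if "q < N ^ n"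
    using div_le_dividend that by (rule le_less_trans)
  moreover have "k * N + i = q \<longleftrightarrow> q mod N = i \<and> k = q div N"
    using assms by (auto simp: div_mult_mod_eq)
  ultimately show "coord (blinfun_apply (truncations N (adjoint_op (cuntz_iso N i)) n) (unit_vec q)) k
    = coord (if q < N ^ n \<and> q mod N = i then unit_vec (q div N) else 0) k"
    using assms by (auto simp: truncations_apply coord_proj coord_adjoint_cuntz_iso coord_unit_vec)
qed

text \<open>Appending a digit before or after the embedding gives the same words
  \<open>v 0 ... 0 r i\<close>; only their weights differ. The difference is controlled by
  \<open>sum_weight_digits_diff_sq\<close>.\<close>

lemma intertwined_cuntz_iso:
  assumes N: "N \<ge> 2" and i: "i < N"
  shows "intertwined N (truncations N (cuntz_iso N i))"
proof -
  let ?S = "truncations N (cuntz_iso N i)"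
  \<comment> \<open>The word indexed by \<open>(r, k)\<close> has \<open>r\<close> padded to k
    digits before \<open>i\<close> is appended and \<open>r * N + i\<close> padded to k + 1 digits
    afterwards; hence the two positions in the difference.\<close>
  define c where "c n r k = (if r * N + i < N ^ n
    then weight n (digits N r) k - weight n (digits N (r * N + i)) (Suc k) else 0)" for n r k
  define \<phi> where "\<phi> v = (\<lambda>(r, k). r * N + i + v * N ^ Suc k)" for v
  have less: "r * N + i < N ^ Suc k" if "c n r k \<noteq> 0" for n r k
  proof (rule ccontr)
    assume "\<not> ?thesis"
    then have "\<not> digits N r \<le> k" "\<not> digits N (r * N + i) \<le> Suc k"
      using mult_add_less_power_iff[OF i, of r k] by (simp_all add: digits_le_iff[OF N])
    then show False using that by (simp add: c_def weight_eq_0 split: if_splits)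
  qed
  show ?thesis
  proof (rule intertwinedI[OF N])
    show "?S \<in> F_eta N" by (intro F_eta_closed_ops clinear_ops_closed_ops)
  next
    fix n m v r assume n: "(n::nat) > 0" and v: "N ^ m \<le> v" "v < N ^ Suc m" and r: "r < N ^ n"
    \<comment> \<open>The image word has m + k + 2 digits, so it survives truncation at level m + 2
      n + 2 exactly when k is at most 2 n.\<close>
    have S: "cscale (weight n (digits N r) k) (blinfun_apply (?S (m + 2 * n + 2)) (unit_vec (r + v * N ^ k)))
        = (if k \<le> 2 * n then cscale (weight n (digits N r) k) (unit_vec (\<phi> v (r, k))) else 0)" for k
    proof (cases "digits N r \<le> k")
      case True
      have eq: "(r + v * N ^ k) * N + i = r * N + i + v * N ^ Suc k" by (simp add: algebra_simps)
      have "r * N + i < N ^ Suc k"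
        using True mult_add_less_power_iff[OF i] by (simp add: digits_le_iff[OF N])
      from tagged_less_power_iff[OF N v this, of "m + 2 * n + 2"]
      have "(r + v * N ^ k) * N + i < N ^ (m + 2 * n + 2) \<longleftrightarrow> k \<le> 2 * n"
        unfolding eq by linarith
      then show ?thesis
        unfolding truncation_cuntz_iso_unit_vec[OF i] eq by (simp add: \<phi>_def)
    qed (simp add: weight_eq_0)
    have "blinfun_apply (?S (m + 2 * n + 2)) (embed N n v (unit_vec r))
        = (\<Sum>k\<le>2 * n + 1. cscale (weight n (digits N r) k) (blinfun_apply (?S (m + 2 * n + 2)) (unit_vec (r + v * N ^ k))))"
      using r clinear_opsD[OF F_eta_clinear[OF F_eta_closed_ops(3)[OF clinear_ops_closed_ops(4)]]]
      by (simp add: embed_unit_vec blinfun.sum_right blinfun.add_right)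
    also have "\<dots> = (\<Sum>k\<le>2 * n. cscale (weight n (digits N r) k) (unit_vec (\<phi> v (r, k))))"
      unfolding S by simp
    finally have 1: "blinfun_apply (?S (m + 2 * n + 2)) (embed N n v (unit_vec r))
        = (\<Sum>k\<le>2 * n. cscale (weight n (digits N r) k) (unit_vec (\<phi> v (r, k))))" .
    show "blinfun_apply (?S (m + 2 * n + 2)) (embed N n v (unit_vec r)) - embed N n v (blinfun_apply (?S n) (unit_vec r))
      = (\<Sum>k\<le>2 * n. cscale (of_real (c n r k)) (unit_vec (\<phi> v (r, k))))"
    proof (cases "r * N + i < N ^ n")
      case True
      then have "embed N n v (blinfun_apply (?S n) (unit_vec r))
          = (\<Sum>k\<le>Suc (2 * n). cscale (weight n (digits N (r * N + i)) k) (unit_vec (r * N + i + v * N ^ k)))"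
        by (simp add: truncation_cuntz_iso_unit_vec[OF i] embed_unit_vec)
      \<comment> \<open>Padding 0 has weight 0, so the index can be shifted by one.\<close>
      also have "\<dots> = (\<Sum>k\<le>2 * n. cscale (weight n (digits N (r * N + i)) (Suc k)) (unit_vec (\<phi> v (r, k))))"
        by (subst sum.atMost_Suc_shift) (simp add: weight_eq_0 \<phi>_def)
      finally show ?thesis
        unfolding 1 using True by (simp add: c_def sum_subtractf ell2.scale_left_diff_distrib)
    next
      \<comment> \<open>Here \<open>r\<close> has full length n, so its only padding is 2 n + 1.
        Truncation then removes the image on both sides.\<close>
      case False
      obtain n' where n': "n = Suc n'" using n by (metis gr0_implies_Suc)
      have "\<not> r < N ^ n'" using False mult_add_less_power_iff[OF i] n' by blast
      then have "digits N r = n" using digits_le_iff[OF N, of r n'] digits_le_iff[OF N, of r n] r n' by simp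
      then show ?thesis
        unfolding 1 using False n by (simp add: c_def truncation_cuntz_iso_unit_vec[OF i] embed_0 weight_top)
    qed
  next
    fix n r assume "(n::nat) > 0" "r < N ^ n"
    then show "(\<Sum>k\<le>2 * n. (c n r k)\<^sup>2) \<le> 2 / real n"
      using sum_weight_digits_diff_sq[OF N _ i, of n r] by (cases "r * N + i < N ^ n") (simp_all add: c_def)
  next
    fix n m v assume v: "N ^ m \<le> v" "v < N ^ Suc m"
    show "inj_on (\<phi> v) {(r, k). r < N ^ n \<and> k \<le> 2 * n \<and> c n r k \<noteq> 0}"
    proof (rule inj_onI, clarify)
      fix r k r' k'
      assume "c n r k \<noteq> 0" "c n r' k' \<noteq> 0" and eq: "\<phi> v (r, k) = \<phi> v (r', k')"
      then have "r * N + i + v * N ^ Suc k = r' * N + i + v * N ^ Suc k'" by (simp add: \<phi>_def)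
      from tagged_inject[OF N v less[OF \<open>c n r k \<noteq> 0\<close>] v less[OF \<open>c n r' k' \<noteq> 0\<close>] this]
      show "r = r' \<and> k = k'" using i by simp
    qed
  qed
qed

text \<open>The same comparison with a final digit \<open>i\<close> deleted. Words with another
  final digit are annihilated on both sides, as the embedding keeps the last digit.\<close>

lemma intertwined_adjoint_cuntz_iso:
  assumes N: "N \<ge> 2" and i: "i < N"
  shows "intertwined N (truncations N (adjoint_op (cuntz_iso N i)))"
proof -
  let ?S = "truncations N (adjoint_op (cuntz_iso N i))"
  define c where "c n r k = (if r mod N = i
    then weight n (digits N r) (Suc k) - weight n (digits N (r div N)) k else 0)" for n r k
  define \<phi> where "\<phi> v = (\<lambda>(r, k). r div N + v * N ^ k)" for v
  have div_less: "r div N < N ^ k \<longleftrightarrow> r < N ^ Suc k" for r k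
    using mult_add_less_power_iff[of "r mod N" N "r div N" k] N by simp
  have less: "r div N < N ^ k" if "c n r k \<noteq> 0" for n r k
  proof (rule ccontr)
    assume "\<not> ?thesis"
    then have "\<not> digits N r \<le> Suc k" "\<not> digits N (r div N) \<le> k"
      using div_less[of r k] by (simp_all add: digits_le_iff[OF N])
    then show False using that by (simp add: c_def weight_eq_0 split: if_splits)
  qed
  have clin: "adjoint_op (cuntz_iso N i) \<in> clinear_ops"
    by (intro adjoint_op_clinear clinear_ops_closed_ops)
  show ?thesis
  proof (rule intertwinedI[OF N])
    show "?S \<in> F_eta N" by (intro F_eta_closed_ops clin)
  next
    fix n m v r assume n: "(n::nat) > 0" and v: "N ^ m \<le> v" "v < N ^ Suc m" and r: "r < N ^ n"
    have S: "cscale (weight n (digits N r) (Suc k)) (blinfun_apply (?S (m + 2 * n + 2)) (unit_vec (r + v * N ^ Suc k)))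
        = cscale (if r mod N = i then weight n (digits N r) (Suc k) else 0) (unit_vec (\<phi> v (r, k)))"
      if "k \<le> 2 * n" for k
    proof (cases "digits N r \<le> Suc k")
      case True
      have "r < N ^ Suc k" using True by (simp only: digits_le_iff[OF N])
      from tagged_less_power_iff[OF N v this, of "m + 2 * n + 2"]
      have less: "r + v * N ^ Suc k < N ^ (m + 2 * n + 2)"
        using that by linarith
      have eq: "r + v * N ^ Suc k = r + v * N ^ k * N" by (simp add: algebra_simps)
      have "(r + v * N ^ Suc k) mod N = r mod N" "(r + v * N ^ Suc k) div N = r div N + v * N ^ k"
        unfolding eq using N by simp_all
      then show ?thesis
        unfolding truncation_adjoint_cuntz_iso_unit_vec[OF i] using less by (simp add: \<phi>_def)
    qed (simp add: weight_eq_0)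
    have "blinfun_apply (?S (m + 2 * n + 2)) (embed N n v (unit_vec r))
        = (\<Sum>k\<le>Suc (2 * n). cscale (weight n (digits N r) k) (blinfun_apply (?S (m + 2 * n + 2)) (unit_vec (r + v * N ^ k))))"
      using r clinear_opsD[OF F_eta_clinear[OF F_eta_closed_ops(3)[OF clin]]]
      by (simp add: embed_unit_vec blinfun.sum_right blinfun.add_right)
    also have "\<dots> = (\<Sum>k\<le>2 * n. cscale (weight n (digits N r) (Suc k))
        (blinfun_apply (?S (m + 2 * n + 2)) (unit_vec (r + v * N ^ Suc k))))"
      by (subst sum.atMost_Suc_shift) (simp add: weight_eq_0)
    also have "\<dots> = (\<Sum>k\<le>2 * n. cscale (if r mod N = i then weight n (digits N r) (Suc k) else 0) (unit_vec (\<phi> v (r, k))))"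
      by (intro sum.cong refl) (simp only: S atMost_iff)
    finally have 1: "blinfun_apply (?S (m + 2 * n + 2)) (embed N n v (unit_vec r)) = \<dots>" .
    show "blinfun_apply (?S (m + 2 * n + 2)) (embed N n v (unit_vec r)) - embed N n v (blinfun_apply (?S n) (unit_vec r))
      = (\<Sum>k\<le>2 * n. cscale (of_real (c n r k)) (unit_vec (\<phi> v (r, k))))"
    proof (cases "r mod N = i")
      case True
      obtain n' where n': "n = Suc n'" using n by (metis gr0_implies_Suc)
      have "r div N < N ^ n'" using r n' div_less by blast
      then have "digits N (r div N) < n" using digits_le_iff[OF N, of "r div N" n'] n' by simp
      \<comment> \<open>After the deletion fewer than n digits remain, so the window ends at 2 n at
        the latest and the term at 2 n + 1 drops out.\<close>
      then have top: "weight n (digits N (r div N)) (Suc (2 * n)) = 0" by (intro weight_eq_0_above) simp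
      have "r div N < N ^ n" using r div_le_dividend le_less_trans by blast
      then have "embed N n v (blinfun_apply (?S n) (unit_vec r))
          = (\<Sum>k\<le>Suc (2 * n). cscale (weight n (digits N (r div N)) k) (unit_vec (r div N + v * N ^ k)))"
        using r True by (simp add: truncation_adjoint_cuntz_iso_unit_vec[OF i] embed_unit_vec)
      also have "\<dots> = (\<Sum>k\<le>2 * n. cscale (weight n (digits N (r div N)) k) (unit_vec (\<phi> v (r, k))))"
        using top by (simp add: \<phi>_def)
      finally show ?thesis
        unfolding 1 using True by (simp add: c_def sum_subtractf ell2.scale_left_diff_distrib)
    qed (unfold 1, simp add: c_def truncation_adjoint_cuntz_iso_unit_vec[OF i] embed_0)
  next
    fix n r assume n: "(n::nat) > 0" "r < N ^ n"
    show "(\<Sum>k\<le>2 * n. (c n r k)\<^sup>2) \<le> 2 / real n"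
    proof (cases "r mod N = i")
      case True
      then have "r div N * N + i = r" by (metis div_mult_mod_eq)
      then show ?thesis
        using sum_weight_digits_diff_sq[OF N n(1) i, of "r div N"] n(2) True
        by (simp add: c_def power2_commute)
    qed (simp add: c_def)
  next
    fix n m v assume v: "N ^ m \<le> v" "v < N ^ Suc m"
    show "inj_on (\<phi> v) {(r, k). r < N ^ n \<and> k \<le> 2 * n \<and> c n r k \<noteq> 0}"
    proof (rule inj_onI, clarify)
      fix r k r' k'
      assume c: "c n r k \<noteq> 0" "c n r' k' \<noteq> 0" and eq: "\<phi> v (r, k) = \<phi> v (r', k')"
      then have "r div N + v * N ^ k = r' div N + v * N ^ k'" by (simp add: \<phi>_def)
      from tagged_inject[OF N v less[OF c(1)] v less[OF c(2)] this]
      have "r div N = r' div N" "k = k'" by simp_all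
      \<comment> \<open>The index forgets the last digit of \<open>r\<close>, but nonzero
        coefficients occur only when that digit is \<open>i\<close>.\<close>
      moreover have "r mod N = r' mod N" using c by (simp add: c_def split: if_splits)
      ultimately show "r = r' \<and> k = k'" by (metis div_mult_mod_eq)
    qed
  qed
qed

section \<open>Truncations of the Cuntz algebra\<close>

lemma truncations_simps:
  "truncations N (A + B) = truncations N A + truncations N B"
  "truncations N (A - B) = truncations N A - truncations N B"
  "truncations N 0 = 0"
  "truncations N (op_cscale c A) = seq_cscale c (truncations N A)"
  by (auto intro!: bcontfun_eqI blinfun_eqI ell2_eqI simp: truncations_apply seq_cscale_apply
      op_cscale_apply blinfun.bilinear_simps coord_proj)

lemma norm_truncations_le: "norm (truncations N A) \<le> norm A"
proof (rule norm_bound)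
  fix n
  have "norm (proj (N ^ n) o\<^sub>L A o\<^sub>L proj (N ^ n)) \<le> norm (proj (N ^ n)) * norm A * norm (proj (N ^ n))"
    by (intro order_trans[OF norm_blinfun_compose] mult_right_mono norm_blinfun_compose norm_ge_zero)
  also have "\<dots> \<le> 1 * norm A * 1"
    by (intro mult_mono norm_proj_le) (simp_all add: mult_left_le_one_le norm_proj_le)
  finally show "norm (truncations N A n) \<le> norm A" by (simp add: truncations_apply)
qed

lemma seq_adjoint_truncations:
  assumes "A \<in> clinear_ops"
  shows "seq_adjoint (truncations N A) = truncations N (adjoint_op A)"
  using assms
  by (intro bcontfun_eqI)
    (simp add: seq_adjoint_apply[of _ N] F_eta_closed_ops truncations_apply adjoint_op_simps
      clinear_ops_closed_ops blinfun_compose_assoc)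

lemma truncations_id: "truncations N id_blinfun = seq_one N"
  by (intro bcontfun_eqI blinfun_eqI ell2_eqI) (simp add: truncations_apply seq_one_apply coord_proj)

text \<open>Coordinate k of the image under the isometry is read off at \<open>k div N\<close>,
  which is no larger. Hence P S = P S P for the truncating projection P, and an inner P may be
  inserted.\<close>

lemma truncations_cuntz_iso_compose:
  assumes "i < N"
  shows "truncations N (cuntz_iso N i o\<^sub>L A) = seq_mult (truncations N (cuntz_iso N i)) (truncations N A)"
proof -
  have "k div N < N ^ n" if "k < N ^ n" for k n
    using div_le_dividend that by (rule le_less_trans)
  then show ?thesis
    by (intro bcontfun_eqI blinfun_eqI ell2_eqI)
      (simp add: truncations_apply seq_mult_apply coord_proj coord_cuntz_iso)
qed

text \<open>The adjoint of the previous multiplicativity, applied to the adjoint of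
  \<open>A\<close>.\<close>

lemma truncations_compose_adjoint_cuntz_iso:
  assumes i: "i < N" and A: "A \<in> clinear_ops"
  shows "truncations N (A o\<^sub>L adjoint_op (cuntz_iso N i))
    = seq_mult (truncations N A) (truncations N (adjoint_op (cuntz_iso N i)))"
proof -
  let ?S = "cuntz_iso N i"
  have S: "?S \<in> clinear_ops" by (rule clinear_ops_closed_ops)
  note closed = S A adjoint_op_clinear F_eta_closed_ops clinear_ops_closed_ops
  have "seq_adjoint (truncations N (?S o\<^sub>L adjoint_op A))
      = seq_adjoint (seq_mult (truncations N ?S) (truncations N (adjoint_op A)))"
    by (simp only: truncations_cuntz_iso_compose[OF i])
  then show ?thesis
    by (simp add: seq_adjoint_truncations closed adjoint_op_simps adjoint_op_adjoint_op
        seq_adjoint_simps[of _ N])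
qed

lemma adjoint_cuntz_iso_compose_cuntz_iso:
  assumes "i < N" "j < N"
  shows "adjoint_op (cuntz_iso N i) o\<^sub>L cuntz_iso N j = (if i = j then id_blinfun else 0)"
  using assms by (intro blinfun_eqI ell2_eqI) (simp add: coord_adjoint_cuntz_iso coord_cuntz_iso)

text \<open>The relation is exact here: the embedding only sees the first \<open>N ^ n\<close>
  coordinates, and its values are fixed by the larger projection.\<close>

lemma intertwined_seq_one:
  assumes "N \<ge> 2"
  shows "intertwined N (seq_one N)"
proof -
  have "embed N n v (blinfun_apply (proj (N ^ n)) x) = embed N n v x" for n v x
    by (simp add: embed_def coord_proj)
  then show ?thesis
    unfolding intertwined_def seq_one_apply
    by (intro allI impI always_eventually) (simp only: proj_embed[OF assms], simp)
qed

lemma seq_one_in_intertwined_algebra: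
  assumes "N \<ge> 2"
  shows "seq_one N \<in> intertwined_algebra N"
proof -
  have "seq_adjoint (seq_one N) = seq_one N"
    by (intro bcontfun_eqI)
      (simp add: seq_adjoint_apply[of _ N] F_eta_closed_ops seq_one_apply adjoint_op_simps)
  then show ?thesis
    by (simp add: intertwined_algebra_def intertwined_seq_one[OF assms] F_eta_closed_ops)
qed

lemma truncation_cuntz_iso_in_intertwined_algebra:
  assumes "N \<ge> 2" "i < N"
  shows "truncations N (cuntz_iso N i) \<in> intertwined_algebra N"
    and "truncations N (adjoint_op (cuntz_iso N i)) \<in> intertwined_algebra N"
  using assms
  by (simp_all add: intertwined_algebra_def intertwined_cuntz_iso intertwined_adjoint_cuntz_iso
      seq_adjoint_truncations clinear_ops_closed_ops adjoint_op_clinear adjoint_op_adjoint_op F_eta_closed_ops)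

lemma intertwined_algebra_closed_ops:
  assumes "N \<ge> 2"
  shows "A \<in> intertwined_algebra N \<Longrightarrow> B \<in> intertwined_algebra N \<Longrightarrow> A + B \<in> intertwined_algebra N"
    and "A \<in> intertwined_algebra N \<Longrightarrow> B \<in> intertwined_algebra N \<Longrightarrow> seq_mult A B \<in> intertwined_algebra N"
    and "A \<in> intertwined_algebra N \<Longrightarrow> seq_cscale c A \<in> intertwined_algebra N"
    and "0 \<in> intertwined_algebra N"
  using cstar_subalgebra_intertwined_algebra[OF assms] by (simp_all add: cstar_subalgebra_def)

text \<open>
  Truncation is not multiplicative, so the operators whose truncations lie in a given algebra need not
  form an algebra. It is multiplicative when an isometry is multiplied from the left or its adjoint
  from the right; testing against all words in the adjoints therefore yields a space that is stable
  under left multiplication by the isometries and by their adjoints.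
\<close>

inductive_set adjoint_words :: "nat \<Rightarrow> ell2_op set" for N where
  id: "id_blinfun \<in> adjoint_words N"
| compose: "W \<in> adjoint_words N \<Longrightarrow> i < N \<Longrightarrow> W o\<^sub>L adjoint_op (cuntz_iso N i) \<in> adjoint_words N"

lemma adjoint_words_clinear: "W \<in> adjoint_words N \<Longrightarrow> W \<in> clinear_ops"
  by (induction rule: adjoint_words.induct) (simp_all add: clinear_ops_closed_ops adjoint_op_clinear)

definition tested_ops :: "nat \<Rightarrow> ell2_op set"
  where "tested_ops N = {A \<in> clinear_ops. \<forall>W\<in>adjoint_words N. truncations N (W o\<^sub>L A) \<in> intertwined_algebra N}"

lemma closed_tested_ops:
  assumes "N \<ge> 2"
  shows "closed (tested_ops N)"
proof -
  have lin: "bounded_linear (truncations N)"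
    by (rule bounded_linear_intro[where K = 1])
      (simp_all add: norm_truncations_le truncations_simps scaleR_blinfun.rep_eq, intro bcontfun_eqI blinfun_eqI ell2_eqI,
        simp add: truncations_apply coord_proj blinfun.scaleR_left blinfun.scaleR_right)
  have "closed {A. truncations N (W o\<^sub>L A) \<in> intertwined_algebra N}" for W
  proof -
    have "bounded_linear (\<lambda>A. truncations N (W o\<^sub>L A))"
      using bounded_linear_compose[OF lin]
        bounded_bilinear.bounded_linear_right[OF bounded_bilinear_blinfun_compose] by blast
    from closed_vimage[OF closed_intertwined_algebra[OF assms] linear_continuous_on[OF this]]
    show ?thesis by (simp add: vimage_def)
  qed
  then have "closed (clinear_ops \<inter> (\<Inter>W\<in>adjoint_words N. {A. truncations N (W o\<^sub>L A) \<in> intertwined_algebra N}))"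
    by (intro closed_Int closed_clinear_ops closed_INT ballI)
  moreover have "clinear_ops \<inter> (\<Inter>W\<in>adjoint_words N. {A. truncations N (W o\<^sub>L A) \<in> intertwined_algebra N}) = tested_ops N"
    by (auto simp: tested_ops_def)
  ultimately show ?thesis by simp
qed

text \<open>Truncation splits off adjoint generators from the right, so the truncation of an adjoint
  word is a product of truncated generators.\<close>

lemma id_in_tested_ops:
  assumes "N \<ge> 2"
  shows "id_blinfun \<in> tested_ops N"
proof -
  have "truncations N W \<in> intertwined_algebra N" if "W \<in> adjoint_words N" for W
    using that
  proof induction
    case id
    then show ?case by (simp add: truncations_id seq_one_in_intertwined_algebra[OF assms])
  next
    case (compose W i)
    then show ?case
      by (simp add: truncations_compose_adjoint_cuntz_iso adjoint_words_clinear
          intertwined_algebra_closed_ops truncation_cuntz_iso_in_intertwined_algebra assms)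
  qed
  moreover have "W o\<^sub>L id_blinfun = W" for W :: ell2_op by (intro blinfun_eqI) simp
  ultimately show ?thesis by (simp add: tested_ops_def clinear_ops_closed_ops)
qed

text \<open>A nonempty word ends in an adjoint generator, whose product with the isometry is the
  identity or 0; for the empty word truncation is multiplicative. Multiplying by an adjoint
  generator instead merely lengthens the word.\<close>

lemma cuntz_iso_compose_in_tested_ops:
  assumes "N \<ge> 2" "i < N" "A \<in> tested_ops N"
  shows "cuntz_iso N i o\<^sub>L A \<in> tested_ops N" and "adjoint_op (cuntz_iso N i) o\<^sub>L A \<in> tested_ops N"
proof -
  have A: "A \<in> clinear_ops" "\<And>W. W \<in> adjoint_words N \<Longrightarrow> truncations N (W o\<^sub>L A) \<in> intertwined_algebra N"
    using assms(3) by (simp_all add: tested_ops_def)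
  have id_left: "id_blinfun o\<^sub>L B = B" for B :: ell2_op by (intro blinfun_eqI) simp
  have "truncations N (W o\<^sub>L (cuntz_iso N i o\<^sub>L A)) \<in> intertwined_algebra N" if "W \<in> adjoint_words N" for W
    using that
  proof cases
    case id
    have "truncations N A \<in> intertwined_algebra N"
      using A(2)[OF adjoint_words.id] by (simp add: id_left)
    then show ?thesis
      by (simp add: id id_left truncations_cuntz_iso_compose[OF assms(2)]
          intertwined_algebra_closed_ops truncation_cuntz_iso_in_intertwined_algebra assms)
  next
    case (compose V j)
    have "W o\<^sub>L (cuntz_iso N i o\<^sub>L A) = V o\<^sub>L ((adjoint_op (cuntz_iso N j) o\<^sub>L cuntz_iso N i) o\<^sub>L A)"
      by (simp only: compose(1) blinfun_compose_assoc)
    also have "\<dots> = (if j = i then V o\<^sub>L A else 0)"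
      using compose(3) assms(2) by (simp add: adjoint_cuntz_iso_compose_cuntz_iso id_left)
    finally show ?thesis
      using A(2)[OF compose(2)] by (simp add: truncations_simps intertwined_algebra_closed_ops assms(1))
  qed
  then show "cuntz_iso N i o\<^sub>L A \<in> tested_ops N"
    using A(1) by (simp add: tested_ops_def clinear_ops_closed_ops)
  show "adjoint_op (cuntz_iso N i) o\<^sub>L A \<in> tested_ops N"
    using A(1) A(2)[OF adjoint_words.compose[OF _ assms(2)]]
    by (simp add: tested_ops_def clinear_ops_closed_ops adjoint_op_clinear blinfun_compose_assoc)
qed

lemma tested_ops_closed_ops:
  assumes "N \<ge> 2"
  shows "0 \<in> tested_ops N"
    and "A \<in> tested_ops N \<Longrightarrow> B \<in> tested_ops N \<Longrightarrow> A + B \<in> tested_ops N"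
    and "A \<in> tested_ops N \<Longrightarrow> op_cscale c A \<in> tested_ops N"
proof -
  have "W o\<^sub>L op_cscale c A = op_cscale c (W o\<^sub>L A)" if "W \<in> adjoint_words N" for W
    by (intro blinfun_eqI) (simp add: op_cscale_apply clinear_opsD[OF adjoint_words_clinear[OF that]])
  then show "A \<in> tested_ops N \<Longrightarrow> op_cscale c A \<in> tested_ops N"
    by (simp add: tested_ops_def clinear_ops_closed_ops truncations_simps intertwined_algebra_closed_ops assms)
qed (simp_all add: tested_ops_def clinear_ops_closed_ops truncations_simps intertwined_algebra_closed_ops assms
    bounded_bilinear.add_right[OF bounded_bilinear_blinfun_compose])

text \<open>The set \<open>tested_ops N\<close> is treated as a left module. The operators that
  preserve it under left multiplication, together with their adjoints, form a C*-algebra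
  \<open>Y\<close> containing the generators.\<close>

lemma cuntz_algebra_subset_tested_ops:
  assumes N: "N \<ge> 2"
  shows "cuntz_algebra N \<subseteq> tested_ops N"
proof
  define Y where "Y = {B \<in> clinear_ops. \<forall>A\<in>tested_ops N. B o\<^sub>L A \<in> tested_ops N \<and> adjoint_op B o\<^sub>L A \<in> tested_ops N}"
  have zero: "0 \<in> Y"
    by (simp add: Y_def clinear_ops_closed_ops adjoint_op_simps tested_ops_closed_ops[OF N])
  have plus: "A + B \<in> Y" and mult: "A o\<^sub>L B \<in> Y" if "A \<in> Y" "B \<in> Y" for A B
    using that
    by (simp_all add: Y_def clinear_ops_closed_ops adjoint_op_simps tested_ops_closed_ops[OF N]
        bounded_bilinear.add_left[OF bounded_bilinear_blinfun_compose] blinfun_compose_assoc)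
  have scale: "op_cscale c A \<in> Y" if "A \<in> Y" for c A
  proof -
    have "op_cscale c B o\<^sub>L C = op_cscale c (B o\<^sub>L C)" for c B C
      by (intro blinfun_eqI) (simp add: op_cscale_apply)
    with that show ?thesis
      by (simp add: Y_def clinear_ops_closed_ops adjoint_op_simps tested_ops_closed_ops[OF N])
  qed
  have adj: "adjoint_op A \<in> Y" if "A \<in> Y" for A
    using that by (simp add: Y_def adjoint_op_clinear adjoint_op_adjoint_op)
  have "closed Y"
    unfolding closed_sequential_limits
  proof (intro allI impI, elim conjE)
    fix B B0 assume B: "\<forall>n. B n \<in> Y" and lim: "B \<longlonglongrightarrow> B0"
    have clin: "B n \<in> clinear_ops" for n using B by (simp add: Y_def)
    then have B0: "B0 \<in> clinear_ops"
      using closed_clinear_ops lim by (metis closed_sequentially)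
    \<comment> \<open>The involution is contractive on complex-linear operators, so the adjoints
      converge along with the operators.\<close>
    have "(\<lambda>n. adjoint_op (B n)) \<longlonglongrightarrow> adjoint_op B0"
    proof (rule metric_tendsto_imp_tendsto[OF lim], rule always_eventually, rule allI)
      fix n show "dist (adjoint_op (B n)) (adjoint_op B0) \<le> dist (B n) B0"
        using norm_adjoint_op_le[of "B n - B0"] clin B0
        by (simp add: dist_norm adjoint_op_diff clinear_ops_closed_ops)
    qed
    then have conv: "(\<lambda>n. adjoint_op (B n) o\<^sub>L A) \<longlonglongrightarrow> (adjoint_op B0 o\<^sub>L A)"
      "(\<lambda>n. B n o\<^sub>L A) \<longlonglongrightarrow> (B0 o\<^sub>L A)" for A
      using lim by (auto intro: bounded_bilinear.tendsto[OF bounded_bilinear_blinfun_compose])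
    have "B0 o\<^sub>L A \<in> tested_ops N" "adjoint_op B0 o\<^sub>L A \<in> tested_ops N" if A: "A \<in> tested_ops N" for A
    proof -
      have "\<And>n. B n o\<^sub>L A \<in> tested_ops N" "\<And>n. adjoint_op (B n) o\<^sub>L A \<in> tested_ops N"
        using B A by (simp_all add: Y_def)
      from closed_sequentially[OF closed_tested_ops[OF N] this(1) conv(2)]
        closed_sequentially[OF closed_tested_ops[OF N] this(2) conv(1)]
      show "B0 o\<^sub>L A \<in> tested_ops N" "adjoint_op B0 o\<^sub>L A \<in> tested_ops N" .
    qed
    with B0 show "B0 \<in> Y" by (simp add: Y_def)
  qed
  with zero plus mult scale adj have "cstar_subalgebra clinear_ops op_cscale (o\<^sub>L) adjoint_op Y"
    unfolding cstar_subalgebra_def by (auto simp: Y_def)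
  moreover have "cuntz_iso N ` {..<N} \<subseteq> Y"
    using cuntz_iso_compose_in_tested_ops[OF N] by (auto simp: Y_def clinear_ops_closed_ops)
  ultimately have "cuntz_algebra N \<subseteq> Y"
    unfolding cuntz_algebra_def cstar_generated_def by blast
  \<comment> \<open>Letting \<open>A\<close> act on the identity, which lies in the module, puts
    \<open>A\<close> itself there.\<close>
  moreover fix A assume "A \<in> cuntz_algebra N"
  ultimately have "A o\<^sub>L id_blinfun \<in> tested_ops N"
    using id_in_tested_ops[OF N] by (auto simp: Y_def)
  moreover have "A o\<^sub>L id_blinfun = A" by (intro blinfun_eqI) simp
  ultimately show "A \<in> tested_ops N" by simp
qed

lemma S_eta_subset_intertwined_algebra:
  assumes "N \<ge> 2"
  shows "S_eta N \<subseteq> intertwined_algebra N"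
proof -
  have "truncations N A \<in> intertwined_algebra N" if "A \<in> cuntz_algebra N" for A
  proof -
    have "truncations N (id_blinfun o\<^sub>L A) \<in> intertwined_algebra N"
      using that cuntz_algebra_subset_tested_ops[OF assms] adjoint_words.id
      by (auto simp: tested_ops_def)
    moreover have "id_blinfun o\<^sub>L A = A" by (intro blinfun_eqI) simp
    ultimately show ?thesis by simp
  qed
  then show ?thesis
    unfolding S_eta_def cstar_generated_def
    using cstar_subalgebra_intertwined_algebra[OF assms] by blast
qed

section \<open>Fredholm sequences and invertibility of matrices\<close>

lemma fredholm_left_parametrix:
  assumes "fredholm N A"
  obtains B K where "B \<in> F_eta N" "K \<in> K_eta N" "seq_mult B A = K + seq_one N"
proof -
  let ?R = "F_eta_ring N" and ?K = "K_eta N"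
  have coset: "?K +>\<^bsub>?R\<^esub> X = (\<lambda>k. k + X) ` ?K" for X
    by (auto simp: a_r_coset_def' F_eta_ring_def)
  have "{A \<in> F_eta N. bdd_above (range (\<lambda>n. rank_op (A n)))} \<subseteq> ?K"
    unfolding K_eta_def by (rule closure_subset)
  moreover have "0 \<in> {A \<in> F_eta N. bdd_above (range (\<lambda>n. rank_op (A n)))}"
    by (simp add: F_eta_closed_ops)
  ultimately have K0: "0 \<in> ?K" by blast
  have mem: "X \<in> ?K +>\<^bsub>?R\<^esub> X" for X
    unfolding coset using K0 by (metis add.left_neutral image_eqI)
  from assms obtain Y where Y: "Y \<in> carrier (?R Quot ?K)"
    "Y \<otimes>\<^bsub>?R Quot ?K\<^esub> (?K +>\<^bsub>?R\<^esub> A) = \<one>\<^bsub>?R Quot ?K\<^esub>"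
    unfolding fredholm_def Units_def by blast
  then obtain B where B: "B \<in> F_eta N" "Y = ?K +>\<^bsub>?R\<^esub> B"
    by (auto simp: FactRing_def A_RCOSETS_def' F_eta_ring_def)
  \<comment> \<open>The product of two cosets is the union of the cosets of products of their
    members. Since 0 lies in \<open>?K\<close>, the representatives are among these members.\<close>
  have "?K +>\<^bsub>?R\<^esub> (B \<otimes>\<^bsub>?R\<^esub> A) \<subseteq> Y \<otimes>\<^bsub>?R Quot ?K\<^esub> (?K +>\<^bsub>?R\<^esub> A)"
    using mem[of A] mem[of B] unfolding B(2) by (auto simp: FactRing_def rcoset_mult_def)
  then have "seq_mult B A \<in> ?K +>\<^bsub>?R\<^esub> seq_one N"
    using mem[of "seq_mult B A"] unfolding Y(2) by (auto simp: FactRing_def F_eta_ring_def)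
  then obtain K where "K \<in> ?K" "seq_mult B A = K + seq_one N"
    unfolding coset by blast
  with B(1) that show thesis by blast
qed

section \<open>Linear algebra of a single matrix\<close>

lemma range_matrix_op_subset_span:
  assumes "A \<in> matrix_ops m"
  shows "range (blinfun_apply A) \<subseteq> ell2.span (unit_vec ` {..<m})"
proof
  fix y assume "y \<in> range (blinfun_apply A)"
  then obtain x where "y = blinfun_apply (proj m) (blinfun_apply A x)"
    using assms unfolding matrix_ops_iff by (metis blinfun_apply_blinfun_compose imageE)
  then show "y \<in> ell2.span (unit_vec ` {..<m})"
    by (simp only: proj_eq_sum, intro ell2.span_sum ell2.span_scale) (auto intro: ell2.span_base)
qed

text \<open>More images than the rank must be dependent. Since \<open>ell2.dependent\<close> speaks
  of sets, two coinciding images are treated apart, with coefficients 1 and -1.\<close>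

lemma matrix_op_dependent_image:
  assumes "A \<in> matrix_ops m" "finite V" "rank_op A < card V"
  obtains a where "\<exists>v\<in>V. a v \<noteq> 0" "(\<Sum>v\<in>V. cscale (a v) (blinfun_apply A (f v))) = 0"
proof (cases "inj_on (\<lambda>v. blinfun_apply A (f v)) V")
  case True
  let ?g = "\<lambda>v. blinfun_apply A (f v)"
  obtain B where B: "B \<subseteq> range (blinfun_apply A)" "ell2.independent B"
    "range (blinfun_apply A) \<subseteq> ell2.span B" "card B = rank_op A"
    unfolding rank_op_def by (rule ell2.basis_exists)
  \<comment> \<open>The range lies in the span of m unit vectors; only for a finite basis does
    \<open>card B\<close> bound the size of independent sets.\<close>
  have "finite B"
    using ell2.independent_span_bound[OF _ B(2), of "unit_vec ` {..<m}"] B(1)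
      range_matrix_op_subset_span[OF assms(1)] by auto
  then have "ell2.dependent (?g ` V)"
    using ell2.independent_span_bound[of B "?g ` V"] B(3,4) assms(3) card_image[OF True] by fastforce
  then obtain u where u: "\<exists>y\<in>?g ` V. u y \<noteq> 0" "(\<Sum>y\<in>?g ` V. cscale (u y) y) = 0"
    using ell2.dependent_finite[of "?g ` V"] assms(2) by auto
  have "(\<Sum>v\<in>V. cscale (u (?g v)) (?g v)) = 0"
    using u(2) by (simp add: sum.reindex[OF True])
  with u(1) that[of "\<lambda>v. u (?g v)"] show thesis by auto
next
  case False
  then obtain v w where vw: "v \<in> V" "w \<in> V" "v \<noteq> w" "blinfun_apply A (f v) = blinfun_apply A (f w)"
    by (auto simp: inj_on_def)
  let ?a = "\<lambda>u. if u = v then 1 else if u = w then -1 else (0::complex)"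
  have "(\<Sum>u\<in>V. cscale (?a u) (blinfun_apply A (f u))) = (\<Sum>u\<in>{v, w}. cscale (?a u) (blinfun_apply A (f u)))"
    using vw assms(2) by (intro sum.mono_neutral_right) auto
  also have "\<dots> = 0" using vw by simp
  finally have "(\<Sum>u\<in>V. cscale (?a u) (blinfun_apply A (f u))) = 0" .
  moreover have "\<exists>u\<in>V. ?a u \<noteq> 0" using vw(1) by (intro bexI[of _ v]) simp_all
  ultimately show thesis by (rule that[rotated])
qed

text \<open>On the finite-dimensional range of the projection the lower bound gives injectivity,
  hence surjectivity by counting dimensions. The same bound controls the norm of the
  inverse.\<close>

lemma bounded_below_is_inverse:
  assumes A: "A \<in> matrix_ops m" and "\<epsilon> > 0"
    and below: "\<And>x. blinfun_apply (proj m) x = x \<Longrightarrow> \<epsilon> * norm x \<le> norm (blinfun_apply A x)"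
  obtains B where "is_inverse m A B" "norm B \<le> 1 / \<epsilon>"
proof -
  let ?P = "\<lambda>x. blinfun_apply (proj m) x"
  let ?E = "unit_vec ` {..<m}"
  have AP: "blinfun_apply A (?P x) = blinfun_apply A x" "?P (blinfun_apply A x) = blinfun_apply A x" for x
    using A unfolding matrix_ops_iff by (metis blinfun_apply_blinfun_compose)+
  have PP: "?P (?P x) = ?P x" for x by (metis proj_proj blinfun_apply_blinfun_compose)
  note lin = clinear_opsD[of A] and A' = A[unfolded matrix_ops_iff]
  have inj: "x = 0" if "?P x = x" "blinfun_apply A x = 0" for x
    using below[OF that(1)] that(2) \<open>\<epsilon> > 0\<close> by (simp add: mult_le_0_iff)
  have unit: "?P (unit_vec k) = unit_vec k" if "k < m" for k
    using that by (intro ell2_eqI) (simp add: coord_proj coord_unit_vec)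
  let ?g = "\<lambda>k. blinfun_apply A (unit_vec k)"
  have coeffs: "\<forall>k<m. u k = 0" if "(\<Sum>k<m. cscale (u k) (?g k)) = 0" for u
  proof -
    let ?x = "\<Sum>k<m. cscale (u k) (unit_vec k)"
    have "?P ?x = ?x"
      by (simp add: blinfun.sum_right clinear_opsD[OF clinear_ops_closed_ops(3)] unit)
    moreover have "blinfun_apply A ?x = 0"
      using that by (simp add: blinfun.sum_right clinear_opsD A')
    ultimately have "?x = 0" by (rule inj)
    then have "(norm ?x)\<^sup>2 = 0" by simp
    then show ?thesis
      unfolding norm_sq_sum_unit_vec[where \<phi> = id, simplified, OF finite_lessThan]
      by (simp add: sum_nonneg_eq_0_iff)
  qed
  have inj_g: "inj_on ?g {..<m}"
  proof (rule inj_onI)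
    fix k l assume kl: "k \<in> {..<m}" "l \<in> {..<m}" "?g k = ?g l"
    have "unit_vec k - unit_vec l = 0"
      by (rule inj) (use kl in \<open>simp_all add: blinfun.diff_right unit\<close>)
    then have "coord (unit_vec k) k = coord (unit_vec l) k" by simp
    then show "k = l" by (simp add: coord_unit_vec split: if_splits)
  qed
  have ind: "ell2.independent (?g ` {..<m})"
  proof
    assume "ell2.dependent (?g ` {..<m})"
    then obtain u where u: "\<exists>y\<in>?g ` {..<m}. u y \<noteq> 0" "(\<Sum>y\<in>?g ` {..<m}. cscale (u y) y) = 0"
      using ell2.dependent_finite[of "?g ` {..<m}"] by auto
    have "(\<Sum>k<m. cscale (u (?g k)) (?g k)) = 0"
      using u(2) by (simp add: sum.reindex[OF inj_g])
    from coeffs[OF this] u(1) show False by auto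
  qed
  have gE: "?g ` {..<m} \<subseteq> ell2.span ?E"
    using range_matrix_op_subset_span[OF A] by auto
  \<comment> \<open>Otherwise m + 1 independent vectors would lie in the span of m unit
    vectors.\<close>
  have "unit_vec k \<in> ell2.span (?g ` {..<m})" if "k < m" for k
  proof (rule ccontr)
    assume k: "unit_vec k \<notin> ell2.span (?g ` {..<m})"
    then have "ell2.independent (insert (unit_vec k) (?g ` {..<m}))"
      using ind by (rule ell2.independent_insertI)
    moreover have "insert (unit_vec k) (?g ` {..<m}) \<subseteq> ell2.span ?E"
      using gE that by (auto intro: ell2.span_base)
    ultimately have "card (insert (unit_vec k) (?g ` {..<m})) \<le> card ?E"
      using ell2.independent_span_bound by blast
    also have "\<dots> \<le> m" using card_image_le[of "{..<m}" unit_vec] by simp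
    finally show False
      using k ell2.span_base by (subst (asm) card_insert_disjoint) (auto simp: card_image[OF inj_g])
  qed
  then have span: "\<exists>u. (\<Sum>y\<in>?g ` {..<m}. cscale (u y) y) = unit_vec k" if "k < m" for k
    using that ell2.span_finite[of "?g ` {..<m}"] by fastforce
  have "\<exists>x. ?P x = x \<and> blinfun_apply A x = unit_vec k" if k: "k < m" for k
  proof -
    obtain u where u: "(\<Sum>y\<in>?g ` {..<m}. cscale (u y) y) = unit_vec k"
      using span[OF k] by blast
    let ?x = "\<Sum>l<m. cscale (u (?g l)) (unit_vec l)"
    have "?P ?x = ?x"
      by (simp add: blinfun.sum_right clinear_opsD[OF clinear_ops_closed_ops(3)] unit)
    moreover have "blinfun_apply A ?x = unit_vec k"
      using u by (simp add: blinfun.sum_right clinear_opsD A' sum.reindex[OF inj_g])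
    ultimately show ?thesis by blast
  qed
  then obtain h where h: "\<And>k. k < m \<Longrightarrow> ?P (h k) = h k" "\<And>k. k < m \<Longrightarrow> blinfun_apply A (h k) = unit_vec k"
    by metis
  \<comment> \<open>The linear extension of the chosen preimages, a right inverse by construction;
    injectivity later makes it a left inverse.\<close>
  define b where "b x = (\<Sum>k<m. cscale (coord x k) (h k))" for x
  have Pb: "?P (b x) = b x" for x
    by (simp add: b_def blinfun.sum_right clinear_opsD[OF clinear_ops_closed_ops(3)] h(1))
  have Ab: "blinfun_apply A (b x) = ?P x" for x
    unfolding proj_eq_sum by (simp add: b_def blinfun.sum_right clinear_opsD A' h(2))
  have norm_b: "norm (b x) \<le> norm x * (1 / \<epsilon>)" for x
  proof -
    have "\<epsilon> * norm (b x) \<le> norm (?P x)" using below[OF Pb, of x] by (simp add: Ab)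
    also have "\<dots> \<le> norm x"
      using norm_blinfun[of "proj m" x] mult_right_mono[OF norm_proj_le, of "norm x" m] by simp
    finally show ?thesis using \<open>\<epsilon> > 0\<close> by (simp add: field_simps)
  qed
  have b_scale: "b (cscale c x) = cscale c (b x)" for c x
    by (simp add: b_def ell2.scale_sum_right)
  have bl: "bounded_linear b"
  proof (rule bounded_linear_intro[OF _ _ norm_b])
    show "b (x + y) = b x + b y" for x y
      by (simp add: b_def ell2.scale_left_distrib sum.distrib)
    show "b (r *\<^sub>R x) = r *\<^sub>R b x" for r x
      by (simp only: scaleR_ell2_cscale b_scale)
  qed
  note app = bounded_linear_Blinfun_apply[OF bl]
  have "b (?P x) = b x" for x by (simp add: b_def coord_proj)
  moreover have "b (blinfun_apply A x) = ?P x" for x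
  proof -
    have "?P (b (blinfun_apply A x) - ?P x) = b (blinfun_apply A x) - ?P x"
      by (simp add: blinfun.diff_right Pb PP)
    moreover have "blinfun_apply A (b (blinfun_apply A x) - ?P x) = 0"
      by (simp add: blinfun.diff_right Ab AP)
    ultimately have "b (blinfun_apply A x) - ?P x = 0" by (rule inj)
    then show ?thesis by simp
  qed
  ultimately have "is_inverse m A (Blinfun b)"
    unfolding is_inverse_def matrix_ops_iff
    by (auto intro!: blinfun_eqI simp: app Pb Ab clinear_ops_def b_scale)
  moreover have "norm (Blinfun b) \<le> 1 / \<epsilon>"
    using norm_b \<open>\<epsilon> > 0\<close> by (intro norm_blinfun_bound) (simp_all add: app mult.commute)
  ultimately show thesis by (rule that)
qed

section \<open>Lower bounds for intertwined Fredholm sequences\<close>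

text \<open>A vector violating the bound yields a nonzero y at level m + 2 n + 2 that is annihilated
  by a sequence of bounded rank close to K and nearly annihilated by A. Then B A = K + 1 bounds the
  norm of y by 3 / 4 of itself.\<close>

lemma fredholm_intertwined_bounded_below:
  assumes N: "N \<ge> 2" and A: "A \<in> F_eta N" "intertwined N A" "fredholm N A"
  obtains \<epsilon> where "\<epsilon> > 0"
    "\<forall>\<^sub>F n in sequentially. \<forall>x. blinfun_apply (proj (N ^ n)) x = x \<longrightarrow> \<epsilon> * norm x \<le> norm (blinfun_apply (A n) x)"
proof -
  obtain B K where BK: "B \<in> F_eta N" "K \<in> K_eta N" "seq_mult B A = K + seq_one N"
    using fredholm_left_parametrix[OF A(3)] .
  then obtain K' where K': "K' \<in> F_eta N" "bdd_above (range (\<lambda>n. rank_op (K' n)))" "dist K' K < 1 / 4"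
    unfolding K_eta_def closure_approachable by (metis (mono_tags, lifting) mem_Collect_eq zero_less_divide_1_iff zero_less_numeral)
  then obtain R where R: "rank_op (K' n) \<le> R" for n by (auto simp: bdd_above_def)
  \<comment> \<open>This number serves twice: as a number of copies exceeding every rank, and as the
    parameter of the tag length.\<close>
  define m where "m = Suc R"
  then have "m > 0" by simp
  \<comment> \<open>The first m numbers with m + 1 digits; there are enough of them because m is
    less than \<open>N ^ m\<close>.\<close>
  define V where "V = {N ^ m..<N ^ m + m}"
  have V: "finite V" "card V = m" by (simp_all add: V_def)
  have tags: "N ^ m \<le> v \<and> v < N ^ Suc m" if "v \<in> V" for v
  proof -
    have "m < N ^ m" using N by (intro power_gt_expt) simp
    moreover have "2 * N ^ m \<le> N * N ^ m" using N by (rule mult_right_mono) simp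
    moreover have "N ^ m \<le> v" "v < N ^ m + m" using that by (simp_all add: V_def)
    ultimately show ?thesis unfolding power_Suc by linarith
  qed
  define \<beta> where "\<beta> = norm B + 1"
  have \<beta>: "\<beta> > 0" "norm (B n) \<le> \<beta>" for n
    using norm_bounded[of B n] by (simp_all add: \<beta>_def add_nonneg_pos)
  \<comment> \<open>The norm of A y will be at most 4 m \<epsilon> times that of y, so this choice
    makes B A y at most half as long as y.\<close>
  define \<epsilon> where "\<epsilon> = 1 / (8 * real m * \<beta>)"
  have "\<epsilon> > 0" using \<beta>(1) by (simp add: \<epsilon>_def m_def)
  have "\<forall>\<^sub>F n in sequentially. \<forall>x. blinfun_apply (proj (N ^ n)) x = x \<longrightarrow> \<epsilon> * norm x \<le> norm (blinfun_apply (A n) x)"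
    using intertwinedD[OF A(2) \<open>\<epsilon> > 0\<close>, of m] eventually_gt_at_top[of 0]
  proof eventually_elim
    case (elim n)
    show ?case
    proof (intro allI impI, rule ccontr)
      fix x assume Px: "blinfun_apply (proj (N ^ n)) x = x" and "\<not> \<epsilon> * norm x \<le> norm (blinfun_apply (A n) x)"
      then have small: "norm (blinfun_apply (A n) x) < \<epsilon> * norm x" by simp
      then have x: "x \<noteq> 0" by auto
      let ?k = "m + 2 * n + 2"
      let ?V = "\<lambda>v. embed N n v x"
      have "rank_op (K' ?k) < card V" using R[of ?k] V(2) by (simp add: m_def)
      then obtain a where a: "\<exists>v\<in>V. a v \<noteq> 0" "(\<Sum>v\<in>V. cscale (a v) (blinfun_apply (K' ?k) (?V v))) = 0"
        by (rule matrix_op_dependent_image[OF F_eta_apply[OF K'(1)] V(1)])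
      define y where "y = (\<Sum>v\<in>V. cscale (a v) (?V v))"
      define s where "s = sqrt (\<Sum>v\<in>V. (cmod (a v))\<^sup>2)"
      have s_sq: "s\<^sup>2 = (\<Sum>v\<in>V. (cmod (a v))\<^sup>2)" by (simp add: s_def sum_nonneg)
      have a_le: "cmod (a v) \<le> s" if "v \<in> V" for v
        unfolding s_def using that V(1) by (intro real_le_rsqrt member_le_sum) simp_all
      have s: "s > 0"
        using a(1) a_le by (metis less_le_trans zero_less_norm_iff)
      \<comment> \<open>The factor 1 / sqrt 2 from \<open>norm_sum_embed_ge\<close> is rounded down
        to 1 / 2.\<close>
      have "(s * norm x / 2)\<^sup>2 \<le> s\<^sup>2 * (norm x)\<^sup>2 / 2"
        by (simp add: power_mult_distrib power_divide)
      also have "\<dots> \<le> (norm y)\<^sup>2"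
        using norm_sum_embed_ge[OF N V(1) tags elim(2), where x = x and a = a] by (simp add: y_def s_sq Px)
      finally have y_ge: "s * norm x / 2 \<le> norm y" by (rule power2_le_imp_le) simp
      then have "norm y > 0" using s x by (smt (verit) half_gt_zero mult_pos_pos zero_less_norm_iff)
      have Py: "blinfun_apply (proj (N ^ ?k)) y = y"
        unfolding y_def blinfun.sum_right clinear_opsD[OF clinear_ops_closed_ops(3)]
        by (intro sum.cong refl) (metis proj_embed[OF N] tags)
      have "K' ?k \<in> clinear_ops" using K'(1) by (rule F_eta_clinear)
      then have K'y: "blinfun_apply (K' ?k) y = 0"
        using a(2) by (simp add: y_def blinfun.sum_right clinear_opsD)
      \<comment> \<open>One \<epsilon> is the intertwining error, the other the smallness of the
        image of x, which the embedding does not enlarge.\<close>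
      have AV: "norm (blinfun_apply (A ?k) (?V v)) \<le> 2 * \<epsilon> * norm x" if "v \<in> V" for v
      proof -
        have "norm (blinfun_apply (A ?k) (?V v) - embed N n v (blinfun_apply (A n) x)) \<le> \<epsilon> * norm x"
          using elim(1) tags[OF that] by blast
        moreover have "norm (embed N n v (blinfun_apply (A n) x)) \<le> \<epsilon> * norm x"
          using norm_embed_le[OF N _ _ elim(2), of m v] tags[OF that] small
          by (metis less_imp_le order_trans)
        ultimately show ?thesis
          using norm_triangle_sub[of "blinfun_apply (A ?k) (?V v)" "embed N n v (blinfun_apply (A n) x)"] by linarith
      qed
      have "blinfun_apply (A ?k) y = (\<Sum>v\<in>V. cscale (a v) (blinfun_apply (A ?k) (?V v)))"
        by (simp only: y_def blinfun.sum_right clinear_opsD[OF F_eta_clinear[OF A(1)]])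
      also have "norm \<dots> \<le> (\<Sum>v\<in>V. s * (2 * \<epsilon> * norm x))"
        using a_le AV s by (intro sum_norm_le) (simp only: norm_cscale, intro mult_mono, simp_all)
      \<comment> \<open>Rewritten so that the last factor is the lower bound for the norm of
        y.\<close>
      also have "\<dots> = 4 * real m * \<epsilon> * (s * norm x / 2)" using V(2) by simp
      also have "\<dots> \<le> 4 * real m * \<epsilon> * norm y" using \<open>\<epsilon> > 0\<close> by (intro mult_left_mono y_ge) simp
      finally have Ay: "norm (blinfun_apply (A ?k) y) \<le> 4 * real m * \<epsilon> * norm y" .
      have "norm (blinfun_apply (B ?k) (blinfun_apply (A ?k) y)) \<le> \<beta> * (4 * real m * \<epsilon> * norm y)"
        using \<beta> by (intro order_trans[OF norm_blinfun] mult_mono Ay) (simp_all add: less_imp_le)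
      also have "\<dots> = norm y / 2" using \<beta>(1) \<open>m > 0\<close> by (simp add: \<epsilon>_def field_simps)
      finally have BAy: "norm (blinfun_apply (B ?k) (blinfun_apply (A ?k) y)) \<le> norm y / 2" .
      have "norm (blinfun_apply (K ?k - K' ?k) y) \<le> 1 / 4 * norm y"
      proof (rule order_trans[OF norm_blinfun mult_right_mono])
        show "norm (K ?k - K' ?k) \<le> 1 / 4"
          using norm_bounded[of "K - K'" ?k] K'(3) by (simp add: dist_norm norm_minus_commute)
      qed simp
      then have Ky: "norm (blinfun_apply (K ?k) y) \<le> norm y / 4"
        unfolding blinfun.diff_left K'y by simp
      have "seq_mult B A ?k = (K + seq_one N) ?k" by (simp only: BK(3))
      then have "B ?k o\<^sub>L A ?k = K ?k + proj (N ^ ?k)"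
        by (simp only: seq_mult_apply plus_bcontfun.rep_eq seq_one_apply)
      then have "blinfun_apply (B ?k) (blinfun_apply (A ?k) y) = blinfun_apply (K ?k) y + y"
        using Py by (metis blinfun.add_left blinfun_apply_blinfun_compose)
      then have "y = blinfun_apply (B ?k) (blinfun_apply (A ?k) y) - blinfun_apply (K ?k) y" by simp
      then have "norm y \<le> norm y / 2 + norm y / 4"
        using norm_triangle_le_diff[OF add_mono[OF BAy Ky]] by metis
      with \<open>norm y > 0\<close> show False by simp
    qed
  qed
  with \<open>\<epsilon> > 0\<close> that show thesis by blast
qed

theorem corollary6p23:
  fixes N :: nat and A :: op_seq
  assumes "N \<ge> 2" and "A \<in> S_eta N" and "fredholm N A"
  shows "stable_seq N A"
proof -
  have "A \<in> intertwined_algebra N"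
    using S_eta_subset_intertwined_algebra[OF assms(1)] assms(2) by blast
  then have A: "A \<in> F_eta N" "intertwined N A" by (simp_all add: intertwined_algebra_def)
  obtain \<epsilon> where "\<epsilon> > 0" and below: "\<forall>\<^sub>F n in sequentially. \<forall>x.
      blinfun_apply (proj (N ^ n)) x = x \<longrightarrow> \<epsilon> * norm x \<le> norm (blinfun_apply (A n) x)"
    using fredholm_intertwined_bounded_below[OF assms(1) A assms(3)] .
  then obtain n0 where n0: "\<And>n x. n \<ge> n0 \<Longrightarrow> blinfun_apply (proj (N ^ n)) x = x \<Longrightarrow>
      \<epsilon> * norm x \<le> norm (blinfun_apply (A n) x)"
    unfolding eventually_sequentially by blast
  have "\<exists>B. is_inverse (N ^ n) (A n) B \<and> norm B \<le> 1 / \<epsilon>" if "n \<ge> n0" for n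
    using bounded_below_is_inverse[OF F_eta_apply[OF A(1)] \<open>\<epsilon> > 0\<close> n0[OF that]] by blast
  with A(1) show ?thesis unfolding stable_seq_def by blast
qed

end
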